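(* Let $n\ge 3$ be odd, let $\Lambda\subset[0,1]^n$ be any (nonempty) finite set of weight vectors with $\nu$ elements, and let $0<\rho<1/3$. Then the estimator $\widehat S_*$ satisfies $$ \mathbf{E}_S\|\widehat S_*-S\|_n^2\le \frac{1+3\rho-2\rho^2}{1-3\rho}\,\min_{\lambda\in\Lambda}\mathbf{E}_S\|\widehat S_\lambda-S\|_n^2+\frac1n\,\mathcal{B}_n(\rho), $$ where $\mathcal{B}_n(\rho)=\Psi_n(\rho)+\kappa(\rho)\,v_n\,\mathbf{E}_S|\widehat\varsigma_n-\varsigma_n|$ with $$ \Psi_n(\rho)=\frac{\rho(1-\rho)\Upsilon^*_n(\rho)+2\nu+2\rho^2(1-\rho)u_{2,n}}{\rho(1-3\rho)}\,\sigma_*,\qquad \kappa(\rho)=\frac{4(1-\rho^2)}{1-3\rho}. $$ If the volatility coefficients $(\sigma_l)_{1\le l\le n}$ are known, so that one takes $\widehat\varsigma_n=\varsigma_n$, then $$ \mathbf{E}_S\|\widehat S_*-S\|_n^2\le \frac{1+3\rho-2\rho^2}{1-3\rho}\,\min_{\lambda\in\Lambda}\mathbf{E}_S\|\widehat S_\lambda-S\|_n^2+\frac1n\,\Psi_n(\rho). $$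
   Context: Model. Observations are $y_j=S(x_j)+\sigma_j\xi_j$, $1\le j\le n$, with $x_j=j/n$, $n$ odd, $S$ an unknown real function on $[0,1]$. The $(\xi_j)_{1\le j\le n}$ are i.i.d. with $\mathbf{E}\xi_1=0$, $\mathbf{E}\xi_1^2=1$, $\mathbf{E}\xi_1^4=\xi^*<\infty$. The $(\sigma_l)_{1\le l\le n}$ are positive random variables (possibly depending on the design points and on $S$), independent of $(\xi_j)_{1\le j\le n}$, with $\max_{1\le l\le n}\sigma_l^2\le\sigma_*$ for a nonrandom constant $\sigma_*>0$. $\mathbf{E}_S$ is expectation under this model. Inner product and basis. $(f,g)_n=\frac1n\sum_{l=1}^n f(x_l)g(x_l)$, $\|f\|_n^2=(f,f)_n$ (a vector in $\mathbb{R}^n$ is identified with the values at $x_1,\dots,x_n$). $\phi_1=1$ and, for $j\ge2$, $\phi_j(x)=\sqrt2\cos(2\pi[j/2]x)$ for $j$ even, $\phi_j(x)=\sqrt2\sin(2\pi[j/2]x)$ for $j$ odd, $[\cdot]$ being the integer part. For odd $n$ one has $(\phi_i,\phi_j)_n=\delta_{ij}$, $1\le i,j\le n$. Estimators. $\widehat\theta_{j,n}=(Y,\phi_j)_n$ with $Y=(y_1,\dots,y_n)'$. For $\lambda=(\lambda(1),\dots,\lambda(n))'\in\Lambda$, $\widehat S_\lambda(x)=\sum_{j=1}^n\lambda(j)\widehat\theta_{j,n}\phi_j(x)$. The integrated noise variance is $\varsigma_n=\frac1n\sum_{l=1}^n\sigma_l^2$, and $\widehat\varsigma_n$ is an arbitrary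 estimator (real random variable computed from the observations) of $\varsigma_n$. Put $\widetilde\theta_{j,n}=\widehat\theta_{j,n}^2-\frac1n\widehat\varsigma_n$, $|\lambda|^2=\sum_{j=1}^n\lambda^2(j)$, $\widehat P_n(\lambda)=|\lambda|^2\widehat\varsigma_n/n$, and $$J_n(\lambda)=\sum_{j=1}^n\lambda^2(j)\widehat\theta_{j,n}^2-2\sum_{j=1}^n\lambda(j)\widetilde\theta_{j,n}+\rho\,\widehat P_n(\lambda).$$ Let $\widehat\lambda$ be a minimizer of $J_n$ over $\Lambda$ (any one of them if not unique), and $\widehat S_*=\widehat S_{\widehat\lambda}$. Constants. $v_n=\max_{\lambda\in\Lambda}\sum_{j=1}^n\lambda(j)$; for $i=1,2$, $u_{i,n}=\max_{\lambda\in\Lambda}\sup_{1\le l\le n}\bigl|\sum_{j=1}^n\lambda^i(j)(\phi_j^2(x_l)-1)\bigr|$, where $\lambda^i(j)=(\lambda(j))^i$; and $$\Upsilon_n^*(\rho)=\frac{16\nu}{\rho}+4u_{1,n}\Bigl(1+\nu\frac{\sqrt{\xi^*}}{\sqrt n}\Bigr)+4\nu v_n\frac{\sqrt{\xi^*}}{\sqrt n}.$$ Expectations of nonnegative random variables take values in $[0,\infty]$, with $0\cdot\infty=0$. *)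

theory Defs
  imports "HOL-Probability.Probability"
begin

text \<open>
  Vectors in \<open>\<real>\<^sup>n\<close> are functions on \<open>nat\<close> of which only the values at \<open>1, \<dots>, n\<close> matter.
  A weight family is a subset of \<open>{1..n} \<rightarrow>\<^sub>E {0..1}\<close>: extensionality makes its cardinality the
  number of weight vectors.  Functions on \<open>[0,1]\<close> are functions \<open>real \<Rightarrow> real\<close>, only ever evaluated at
  the design points.
\<close>

definition design :: "nat \<Rightarrow> nat \<Rightarrow> real" where
  "design n j = real j / real n"

definition at_design :: "nat \<Rightarrow> (real \<Rightarrow> real) \<Rightarrow> nat \<Rightarrow> real" where
  "at_design n f l = f (design n l)"

definition emp_inner :: "nat \<Rightarrow> (nat \<Rightarrow> real) \<Rightarrow> (nat \<Rightarrow> real) \<Rightarrow> real" where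
  "emp_inner n u v = 1 / real n * (\<Sum>l=1..n. u l * v l)"

definition emp_norm_sq :: "nat \<Rightarrow> (nat \<Rightarrow> real) \<Rightarrow> real" where
  "emp_norm_sq n u = emp_inner n u u"

text \<open>The basis is indexed from 1; the value at index 0 is never used.\<close>

definition trig_basis :: "nat \<Rightarrow> real \<Rightarrow> real" where
  "trig_basis j x =
     (if j = 1 then 1
      else if even j then sqrt 2 * cos (2 * pi * real (j div 2) * x)
      else sqrt 2 * sin (2 * pi * real (j div 2) * x))"

definition observations ::
  "nat \<Rightarrow> (real \<Rightarrow> real) \<Rightarrow> (nat \<Rightarrow> 'a \<Rightarrow> real) \<Rightarrow> (nat \<Rightarrow> 'a \<Rightarrow> real) \<Rightarrow> 'a \<Rightarrow> nat \<Rightarrow> real" where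
  "observations n S \<sigma> \<xi> \<omega> j = S (design n j) + \<sigma> j \<omega> * \<xi> j \<omega>"

definition int_noise_var :: "nat \<Rightarrow> (nat \<Rightarrow> 'a \<Rightarrow> real) \<Rightarrow> 'a \<Rightarrow> real" where
  "int_noise_var n \<sigma> \<omega> = 1 / real n * (\<Sum>l=1..n. (\<sigma> l \<omega>)\<^sup>2)"

text \<open>In the following, \<open>y\<close> is the observed vector and \<open>c\<close> the value of the estimator of the integrated
  noise variance.\<close>

definition theta_hat :: "nat \<Rightarrow> (nat \<Rightarrow> real) \<Rightarrow> nat \<Rightarrow> real" where
  "theta_hat n y j = emp_inner n y (at_design n (trig_basis j))"

definition S_hat :: "nat \<Rightarrow> (nat \<Rightarrow> real) \<Rightarrow> (nat \<Rightarrow> real) \<Rightarrow> real \<Rightarrow> real" where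
  "S_hat n y lam x = (\<Sum>j=1..n. lam j * theta_hat n y j * trig_basis j x)"

definition theta_tilde :: "nat \<Rightarrow> (nat \<Rightarrow> real) \<Rightarrow> real \<Rightarrow> nat \<Rightarrow> real" where
  "theta_tilde n y c j = (theta_hat n y j)\<^sup>2 - 1 / real n * c"

definition weight_norm_sq :: "nat \<Rightarrow> (nat \<Rightarrow> real) \<Rightarrow> real" where
  "weight_norm_sq n lam = (\<Sum>j=1..n. (lam j)\<^sup>2)"

definition penalty :: "nat \<Rightarrow> real \<Rightarrow> (nat \<Rightarrow> real) \<Rightarrow> real" where
  "penalty n c lam = weight_norm_sq n lam * c / real n"

definition cost :: "nat \<Rightarrow> real \<Rightarrow> (nat \<Rightarrow> real) \<Rightarrow> real \<Rightarrow> (nat \<Rightarrow> real) \<Rightarrow> real" where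
  "cost n \<rho> y c lam =
     (\<Sum>j=1..n. (lam j)\<^sup>2 * (theta_hat n y j)\<^sup>2)
     - 2 * (\<Sum>j=1..n. lam j * theta_tilde n y c j)
     + \<rho> * penalty n c lam"

text \<open>
  The empirical quadratic risk, in \<open>[0,\<infinity>]\<close>, of the weighted estimator with a weight vector that may
  depend on the outcome; a fixed \<open>\<lambda>\<close> enters as the constant function.
\<close>

definition risk ::
  "'a measure \<Rightarrow> nat \<Rightarrow> (real \<Rightarrow> real) \<Rightarrow> (nat \<Rightarrow> 'a \<Rightarrow> real) \<Rightarrow> (nat \<Rightarrow> 'a \<Rightarrow> real)
    \<Rightarrow> ('a \<Rightarrow> nat \<Rightarrow> real) \<Rightarrow> ennreal" where
  "risk M n S \<sigma> \<xi> L =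
     (\<integral>\<^sup>+\<omega>. ennreal (emp_norm_sq n
        (at_design n (\<lambda>x. S_hat n (observations n S \<sigma> \<xi> \<omega>) (L \<omega>) x - S x))) \<partial>M)"

definition v_const :: "nat \<Rightarrow> (nat \<Rightarrow> real) set \<Rightarrow> real" where
  "v_const n \<Lambda> = (MAX lam\<in>\<Lambda>. \<Sum>j=1..n. lam j)"

definition u_const :: "nat \<Rightarrow> nat \<Rightarrow> (nat \<Rightarrow> real) set \<Rightarrow> real" where
  "u_const i n \<Lambda> =
     (MAX lam\<in>\<Lambda>. MAX l\<in>{1..n}.
        \<bar>\<Sum>j=1..n. lam j ^ i * ((trig_basis j (design n l))\<^sup>2 - 1)\<bar>)"

text \<open>Below, \<open>\<xi>s\<close> is the fourth moment of the noise and \<open>\<sigma>s\<close> the bound on the squared volatilities.\<close>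

definition Upsilon_star :: "nat \<Rightarrow> (nat \<Rightarrow> real) set \<Rightarrow> real \<Rightarrow> real \<Rightarrow> real" where
  "Upsilon_star n \<Lambda> \<xi>s \<rho> =
     16 * real (card \<Lambda>) / \<rho>
     + 4 * u_const 1 n \<Lambda> * (1 + real (card \<Lambda>) * (sqrt \<xi>s / sqrt (real n)))
     + 4 * real (card \<Lambda>) * v_const n \<Lambda> * (sqrt \<xi>s / sqrt (real n))"

definition Psi :: "nat \<Rightarrow> (nat \<Rightarrow> real) set \<Rightarrow> real \<Rightarrow> real \<Rightarrow> real \<Rightarrow> real" where
  "Psi n \<Lambda> \<xi>s \<sigma>s \<rho> =
     (\<rho> * (1 - \<rho>) * Upsilon_star n \<Lambda> \<xi>s \<rho> + 2 * real (card \<Lambda>)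
        + 2 * \<rho>\<^sup>2 * (1 - \<rho>) * u_const 2 n \<Lambda>)
     / (\<rho> * (1 - 3 * \<rho>)) * \<sigma>s"

definition kappa :: "real \<Rightarrow> real" where
  "kappa \<rho> = 4 * (1 - \<rho>\<^sup>2) / (1 - 3 * \<rho>)"

text \<open>Here \<open>vhat\<close> is the estimator of the integrated noise variance, as a random variable.\<close>

definition B_term ::
  "'a measure \<Rightarrow> nat \<Rightarrow> (nat \<Rightarrow> real) set \<Rightarrow> (nat \<Rightarrow> 'a \<Rightarrow> real) \<Rightarrow> real \<Rightarrow> real \<Rightarrow> real
    \<Rightarrow> ('a \<Rightarrow> real) \<Rightarrow> ennreal" where
  "B_term M n \<Lambda> \<sigma> \<xi>s \<sigma>s \<rho> vhat =
     ennreal (Psi n \<Lambda> \<xi>s \<sigma>s \<rho>)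
     + ennreal (kappa \<rho> * v_const n \<Lambda>) * (\<integral>\<^sup>+\<omega>. ennreal \<bar>vhat \<omega> - int_noise_var n \<sigma> \<omega>\<bar> \<partial>M)"

end

theory Submission
  imports Defs
begin

text \<open>
  Since the empirical error of \<open>a\<close> and its cost differ, up to a constant, by
  \<open>2 \<Sum> a\<^sub>j \<theta>\<^sub>j z\<^sub>j + 2 \<Sum> a\<^sub>j (z\<^sub>j\<^sup>2 - c / n) - \<rho> |a|\<^sup>2 c / n\<close>, where \<open>z\<close> are the Fourier coefficients of the
  noise, minimality of the cost reduces the theorem to controlling two noise terms at the random
  minimizer.  Both are made uniform over the finite weight family by Young's inequality \<open>2|m| \<le> t N + m\<^sup>2 / (t N)\<close>, the
  quotient \<open>m\<^sup>2 / N\<close> being bounded by its sum over the family.  In the linear term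
  \<open>N = \<Sum> (a\<^sub>j - b\<^sub>j)\<^sup>2 \<theta>\<^sub>j\<^sup>2\<close> is absorbed by the errors of \<open>a\<close> and \<open>b\<close>, which produces the factor
  \<open>1 - 3 \<rho>\<close>.  In the quadratic term the diagonal is treated by Cauchy-Schwarz, and the
  off-diagonal part by Young's inequality with \<open>N\<close> close to the penalty \<open>|a|\<^sup>2 \<varsigma> / n\<close>: for the minimizer this is compensated by the
  penalty in the cost, for the competitor \<open>b\<close> its expectation is at most the risk up to a small
  correction.  All moments are computed with the volatilities frozen, by independence and Fubini.
\<close>

section \<open>The trigonometric basis at the design points\<close>

text \<open>The obstacle is that the minimizer depends on the noise, while expectations are
  accessible for fixed weights only. So every bound is first proved for each outcome, with a random
  part dominated by a sum over \<open>\<Lambda>\<close>; this costs the factor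
  \<open>card \<Lambda>\<close>. The denominators in Young's inequality are chosen so that each
  quotient has mean of order \<open>\<sigma>s\<close> / n, whatever the signal and the weight. In
  the linear term N involves the true coefficients; passing to the observed ones creates a second
  linear term with the same N, again treated by Young. The resulting bound \<rho> / (1 - \<rho>) (2
  E + 2 F), with E and F the errors of a and b, leaves 1 - 2 \<rho> / (1 - \<rho>) = (1 - 3 \<rho>)
  / (1 - \<rho>) in front of E. In the off-diagonal term, bounding one volatility of each product
  and keeping the other makes the variance proportional to |a|^2 \<varsigma> / n up to a correction
  with u_{2,n}, so the penalty can serve as denominator. Young's parameter \<rho> / 4 there gives
  the 16 in \<open>Upsilon_star\<close> and raises the coefficient of the penalty of b to 5/4
  \<rho>, within the 2 \<rho> that the theorem allows.\<close>

lemma sum_cis_design: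
  fixes k :: int
  assumes "n > 0" and "\<not> int n dvd k"
  shows "(\<Sum>l=1..n. cis (2 * pi * of_int k * design n l)) = 0"
proof -
  define w where "w = cis (2 * pi * of_int k / n)"
  have w: "cis (2 * pi * of_int k * design n l) = w ^ l" for l
    by (simp add: w_def design_def Complex.DeMoivre mult_ac)
  \<comment> \<open>\<open>w\<close> is an n-th root of unity other than 1, so its geometric sum
    over a full period vanishes.\<close>
  have "w ^ n = 1"
    using assms(1) by (simp add: w_def Complex.DeMoivre cis_multiple_2pi)
  have "w \<noteq> 1"
  proof
    assume "w = 1"
    then have "cos (2 * pi * of_int k / n) = 1"
      by (simp add: w_def complex_eq_iff)
    then obtain m :: int where "2 * pi * of_int k / n = of_int m * 2 * pi"
      using cos_one_2pi_int by auto
    then have "real_of_int k = of_int (m * int n)"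
      using assms(1) by (simp add: field_simps)
    then have "k = m * int n"
      by (simp only: of_int_eq_iff)
    then show False using assms(2) by simp
  qed
  have "(\<Sum>l=1..n. w ^ l) = w * (\<Sum>l<n. w ^ l)"
    by (simp add: sum_distrib_left sum.atLeast1_atMost_eq)
  also have "\<dots> = 0"
    using \<open>w \<noteq> 1\<close> \<open>w ^ n = 1\<close> by (simp add: sum_gp_strict)
  finally show ?thesis by (simp add: w)
qed

lemma sum_cos_design:
  fixes k :: int
  assumes "n > 0" and "\<not> int n dvd k"
  shows "(\<Sum>l=1..n. cos (2 * pi * of_int k * design n l)) = 0"
  using sum_cis_design[OF assms] by (simp add: complex_eq_iff)

text \<open>Unlike for the cosines, a frequency divisible by n is harmless: every sine then sits at
  a multiple of \<pi>.\<close>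

lemma sum_sin_design:
  fixes k :: int
  assumes "n > 0"
  shows "(\<Sum>l=1..n. sin (2 * pi * of_int k * design n l)) = 0"
proof (cases "int n dvd k")
  case True
  then obtain m where m: "k = int n * m" by blast
  have "sin (2 * pi * of_int k * design n l) = 0" for l
  proof -
    have "2 * pi * of_int k * design n l = of_int (2 * m * int l) * pi"
      using assms by (simp add: m design_def)
    then show ?thesis by (simp only: sin_int_times_real mult.commute) (metis mult.commute sin_zero_iff_int2)
  qed
  then show ?thesis by simp
next
  case False
  then show ?thesis using sum_cis_design[OF assms False] by (simp add: complex_eq_iff)
qed

text \<open>Products of basis functions turn into cosines and sines of the sum and the difference of
  the two frequencies, and these sum to zero over the design unless the frequency is a multiple of
  n.\<close>

lemma sum_trig_basis_orthogonal:
  assumes "odd n" and i: "i \<in> {1..n}" and j: "j \<in> {1..n}"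
  shows "(\<Sum>l=1..n. trig_basis i (design n l) * trig_basis j (design n l)) = (if i = j then real n else 0)"
proof -
  have n: "n > 0" using assms(1) by (cases n) auto
  define a b where "a = int (i div 2)" and "b = int (j div 2)"
  define c where "c k = (\<Sum>l=1..n. cos (2 * pi * of_int k * design n l))" for k :: int
  define s where "s k = (\<Sum>l=1..n. sin (2 * pi * of_int k * design n l))" for k :: int
  have c0: "c 0 = n" by (simp add: c_def)
  have ck: "c k = 0" if "k \<noteq> 0" "\<bar>k\<bar> < int n" for k
    unfolding c_def using that n zdvd_imp_le[of "int n" "\<bar>k\<bar>"]
    by (intro sum_cos_design) auto
  have s0: "s k = 0" for k
    unfolding s_def using sum_sin_design n by blast
  \<comment> \<open>Oddness of n enters here: frequencies are at most (n - 1) / 2, so their sum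
    stays below n and cannot alias to frequency 0.\<close>
  have bd: "\<bar>a - b\<bar> < int n" "0 \<le> a" "0 \<le> b" "a + b < int n"
  proof -
    obtain m where m: "n = 2 * m + 1" using assms(1) by (rule oddE)
    then have "a \<le> int m" "b \<le> int m" "0 \<le> a" "0 \<le> b"
      using i j unfolding a_def b_def by auto
    then show "\<bar>a - b\<bar> < int n" "0 \<le> a" "0 \<le> b" "a + b < int n"
      using m by auto
  qed
  have fa: "trig_basis i x = (if i = 1 then 1 else if even i then sqrt 2 * cos (2 * pi * of_int a * x)
      else sqrt 2 * sin (2 * pi * of_int a * x))" for x
    by (simp add: trig_basis_def a_def)
  have fb: "trig_basis j x = (if j = 1 then 1 else if even j then sqrt 2 * cos (2 * pi * of_int b * x)
      else sqrt 2 * sin (2 * pi * of_int b * x))" for x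
    by (simp add: trig_basis_def b_def)
  have r2: "(sqrt 2 * p) * (sqrt 2 * q) = 2 * (p * q)" for p q :: real
    by simp
  have cc: "(\<Sum>l=1..n. (sqrt 2 * cos (2 * pi * of_int a * design n l)) * (sqrt 2 * cos (2 * pi * of_int b * design n l)))
      = c (a - b) + c (a + b)"
    unfolding c_def sum.distrib[symmetric]
    by (rule sum.cong) (simp_all add: r2 cos_times_cos ring_distribs add_divide_distrib diff_divide_distrib)
  have ss: "(\<Sum>l=1..n. (sqrt 2 * sin (2 * pi * of_int a * design n l)) * (sqrt 2 * sin (2 * pi * of_int b * design n l)))
      = c (a - b) - c (a + b)"
    unfolding c_def sum_subtractf[symmetric]
    by (rule sum.cong) (simp_all add: r2 sin_times_sin ring_distribs add_divide_distrib diff_divide_distrib)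
  have sc: "(\<Sum>l=1..n. (sqrt 2 * sin (2 * pi * of_int a * design n l)) * (sqrt 2 * cos (2 * pi * of_int b * design n l)))
      = s (a + b) + s (a - b)"
    unfolding s_def sum.distrib[symmetric]
    by (rule sum.cong) (simp_all add: r2 sin_times_cos ring_distribs add_divide_distrib diff_divide_distrib)
  have cs: "(\<Sum>l=1..n. (sqrt 2 * cos (2 * pi * of_int a * design n l)) * (sqrt 2 * sin (2 * pi * of_int b * design n l)))
      = s (a + b) - s (a - b)"
    unfolding s_def sum_subtractf[symmetric]
    by (rule sum.cong) (simp_all add: r2 cos_times_sin ring_distribs add_divide_distrib diff_divide_distrib)
  have c1: "(\<Sum>l=1..n. sqrt 2 * cos (2 * pi * of_int k * design n l)) = sqrt 2 * c k" for k
    unfolding c_def by (simp add: sum_distrib_left)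
  have s1: "(\<Sum>l=1..n. sqrt 2 * sin (2 * pi * of_int k * design n l)) = sqrt 2 * s k" for k
    unfolding s_def by (simp add: sum_distrib_left)
  have pa: "i \<noteq> 1 \<Longrightarrow> a > 0" "j \<noteq> 1 \<Longrightarrow> b > 0"
    using i j by (auto simp: a_def b_def)
  have eqp: "a = b \<Longrightarrow> even i = even j \<Longrightarrow> i = j"
    unfolding a_def b_def by (metis dvd_mult_div_cancel odd_two_times_div_two_succ of_nat_eq_iff)
  show ?thesis
  proof (cases "i = 1 \<or> j = 1")
    case True
    consider "i = 1" "j = 1" | "i = 1" "j \<noteq> 1" | "i \<noteq> 1" "j = 1" using True by blast
    then show ?thesis
    proof cases
      case 1 then show ?thesis by (simp add: trig_basis_def)
    next
      case 2 then show ?thesis using pa bd unfolding fa fb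
        by (cases "even j") (simp_all add: c1 s1 s0 ck del: One_nat_def)
    next
      case 3 then show ?thesis using pa bd unfolding fa fb
        by (cases "even i") (simp_all add: c1 s1 s0 ck del: One_nat_def)
    qed
  next
    case False
    then have p: "a > 0" "b > 0" "i \<noteq> 1" "j \<noteq> 1" using pa by auto
    have s2: "c (a + b) = 0" using p bd by (intro ck) auto
    have d2: "c (a - b) = (if a = b then n else 0)" using bd c0 by (auto intro: ck)
    have ij: "i = j \<longleftrightarrow> a = b \<and> even i = even j" using eqp by (auto simp: a_def b_def)
    show ?thesis
      unfolding fa fb ij using p s2 d2
      by (cases "even i"; cases "even j") (simp_all only: if_False if_True cc ss sc cs s0, simp_all)
  qed
qed

section \<open>Moments of the standardized noise\<close>

text \<open>Lets a product of a few noise variables be written as one monomial over all indices, to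
  which the product rule for independent variables applies; repeated indices simply add
  exponents.\<close>

lemma prod_power_of_bool:
  fixes x :: "nat \<Rightarrow> real"
  assumes "i \<in> {1..n}"
  shows "(\<Prod>m=1..n. x m ^ of_bool (m = i)) = x i"
proof -
  have "(\<Prod>m=1..n. x m ^ of_bool (m = i)) = (\<Prod>m=1..n. if m = i then x m else 1)"
    by (intro prod.cong) auto
  then show ?thesis using assms by simp
qed

text \<open>Serves three orthogonal systems: the noise itself, its centred squares, and its products
  over pairs of distinct indices.\<close>

lemma (in prob_space) expectation_sq_sum_orthogonal:
  fixes Z :: "'i \<Rightarrow> 'a \<Rightarrow> real"
  assumes "\<And>i j. i \<in> I \<Longrightarrow> j \<in> I \<Longrightarrow> integrable M (\<lambda>\<omega>. Z i \<omega> * Z j \<omega>)"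
    and "\<And>i j. i \<in> I \<Longrightarrow> j \<in> I \<Longrightarrow> expectation (\<lambda>\<omega>. Z i \<omega> * Z j \<omega>) = (if i = j then w else 0)"
    and "finite I"
  shows "integrable M (\<lambda>\<omega>. (\<Sum>i\<in>I. a i * Z i \<omega>)\<^sup>2)"
    and "expectation (\<lambda>\<omega>. (\<Sum>i\<in>I. a i * Z i \<omega>)\<^sup>2) = w * (\<Sum>i\<in>I. (a i)\<^sup>2)"
proof -
  have eq: "(\<Sum>i\<in>I. a i * Z i \<omega>)\<^sup>2 = (\<Sum>i\<in>I. \<Sum>j\<in>I. (a i * a j) * (Z i \<omega> * Z j \<omega>))" for \<omega>
    by (simp add: power2_eq_square sum_product mult_ac)
  show "integrable M (\<lambda>\<omega>. (\<Sum>i\<in>I. a i * Z i \<omega>)\<^sup>2)"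
    unfolding eq using assms by (intro Bochner_Integration.integrable_sum integrable_mult_right) auto
  have "expectation (\<lambda>\<omega>. (\<Sum>i\<in>I. a i * Z i \<omega>)\<^sup>2)
      = (\<Sum>i\<in>I. \<Sum>j\<in>I. (a i * a j) * expectation (\<lambda>\<omega>. Z i \<omega> * Z j \<omega>))"
    unfolding eq using assms by (simp add: Bochner_Integration.integral_sum Bochner_Integration.integrable_sum)
  also have "\<dots> = (\<Sum>i\<in>I. \<Sum>j\<in>I. if i = j then w * (a i)\<^sup>2 else 0)"
    using assms by (intro sum.cong refl) (auto simp: power2_eq_square)
  also have "\<dots> = w * (\<Sum>i\<in>I. (a i)\<^sup>2)"
    using assms by (simp add: sum_distrib_left)
  finally show "expectation (\<lambda>\<omega>. (\<Sum>i\<in>I. a i * Z i \<omega>)\<^sup>2) = w * (\<Sum>i\<in>I. (a i)\<^sup>2)" .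
qed

text \<open>Beyond independence, the noise enters only through moments up to the fourth, so the
  locale records these in place of equality of laws.\<close>

locale standardized_noise = prob_space M for M :: "'a measure" +
  fixes n :: nat and \<xi> :: "nat \<Rightarrow> 'a \<Rightarrow> real" and \<xi>s :: real
  assumes indep: "indep_vars (\<lambda>_. borel) \<xi> {1..n}"
    and fourth_integrable: "j \<in> {1..n} \<Longrightarrow> integrable M (\<lambda>\<omega>. \<xi> j \<omega> ^ 4)"
    and first_moment: "j \<in> {1..n} \<Longrightarrow> expectation (\<xi> j) = 0"
    and second_moment: "j \<in> {1..n} \<Longrightarrow> expectation (\<lambda>\<omega>. (\<xi> j \<omega>)\<^sup>2) = 1"
    and fourth_moment: "j \<in> {1..n} \<Longrightarrow> expectation (\<lambda>\<omega>. \<xi> j \<omega> ^ 4) = \<xi>s"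
begin

lemma noise_measurable [measurable]: "j \<in> {1..n} \<Longrightarrow> \<xi> j \<in> borel_measurable M"
  using indep by (auto simp: indep_vars_def)

lemma power_integrable:
  assumes j: "j \<in> {1..n}" and "k \<le> 4"
  shows "integrable M (\<lambda>\<omega>. \<xi> j \<omega> ^ k)"
proof (rule Bochner_Integration.integrable_bound)
  show "integrable M (\<lambda>\<omega>. 1 + \<xi> j \<omega> ^ 4)" using fourth_integrable[OF j] by simp
  show "(\<lambda>\<omega>. \<xi> j \<omega> ^ k) \<in> borel_measurable M" using j by measurable
  have "\<bar>x\<bar> ^ k \<le> 1 + \<bar>x\<bar> ^ 4" for x :: real
  proof (cases "\<bar>x\<bar> \<le> 1")
    case True
    then have "\<bar>x\<bar> ^ k \<le> 1" by (simp add: power_le_one)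
    then show ?thesis by (smt (verit) zero_le_power abs_ge_zero)
  next
    case False
    then show ?thesis using power_increasing[OF \<open>k \<le> 4\<close>, of "\<bar>x\<bar>"] by simp
  qed
  then show "AE \<omega> in M. norm (\<xi> j \<omega> ^ k) \<le> norm (1 + \<xi> j \<omega> ^ 4)"
    by (intro AE_I2) (simp add: power_abs)
qed

lemma monomial:
  assumes "\<And>i. i \<in> {1..n} \<Longrightarrow> e i \<le> 4"
  shows "integrable M (\<lambda>\<omega>. \<Prod>i=1..n. \<xi> i \<omega> ^ e i)"
    and "expectation (\<lambda>\<omega>. \<Prod>i=1..n. \<xi> i \<omega> ^ e i) = (\<Prod>i=1..n. expectation (\<lambda>\<omega>. \<xi> i \<omega> ^ e i))"
proof -
  have ind: "indep_vars (\<lambda>_. borel) (\<lambda>i \<omega>. \<xi> i \<omega> ^ e i) {1..n}"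
    by (rule indep_vars_compose2[OF indep, where N = "\<lambda>_. borel"]) auto
  have int: "i \<in> {1..n} \<Longrightarrow> integrable M (\<lambda>\<omega>. \<xi> i \<omega> ^ e i)" for i
    using power_integrable assms by blast
  show "integrable M (\<lambda>\<omega>. \<Prod>i=1..n. \<xi> i \<omega> ^ e i)"
    by (rule indep_vars_integrable) (use ind int in auto)
  show "expectation (\<lambda>\<omega>. \<Prod>i=1..n. \<xi> i \<omega> ^ e i) = (\<Prod>i=1..n. expectation (\<lambda>\<omega>. \<xi> i \<omega> ^ e i))"
    by (rule indep_vars_lebesgue_integral) (use ind int in auto)
qed

lemma four_product:
  assumes "i \<in> {1..n}" "j \<in> {1..n}" "k \<in> {1..n}" "l \<in> {1..n}"
  defines "e \<equiv> \<lambda>m. of_bool (m = i) + of_bool (m = j) + of_bool (m = k) + of_bool (m = l)"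
  shows "integrable M (\<lambda>\<omega>. \<xi> i \<omega> * \<xi> j \<omega> * (\<xi> k \<omega> * \<xi> l \<omega>))"
    and "expectation (\<lambda>\<omega>. \<xi> i \<omega> * \<xi> j \<omega> * (\<xi> k \<omega> * \<xi> l \<omega>)) = (\<Prod>m=1..n. expectation (\<lambda>\<omega>. \<xi> m \<omega> ^ e m))"
proof -
  have eq: "(\<Prod>m=1..n. \<xi> m \<omega> ^ e m) = \<xi> i \<omega> * \<xi> j \<omega> * (\<xi> k \<omega> * \<xi> l \<omega>)" for \<omega>
    using assms(1-4) by (simp add: e_def power_add prod.distrib prod_power_of_bool mult_ac del: One_nat_def atLeastAtMost_iff)
  have "e m \<le> 4" for m by (auto simp: e_def)
  note m = monomial[of e, OF this]
  show "integrable M (\<lambda>\<omega>. \<xi> i \<omega> * \<xi> j \<omega> * (\<xi> k \<omega> * \<xi> l \<omega>))" using m(1) unfolding eq .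
  show "expectation (\<lambda>\<omega>. \<xi> i \<omega> * \<xi> j \<omega> * (\<xi> k \<omega> * \<xi> l \<omega>)) = (\<Prod>m=1..n. expectation (\<lambda>\<omega>. \<xi> m \<omega> ^ e m))"
    using m(2) unfolding eq .
qed

text \<open>An index that occurs only once contributes the factor E \<xi>_i = 0.\<close>

lemma four_product_zero:
  assumes "i \<in> {1..n}" "j \<in> {1..n}" "k \<in> {1..n}" "l \<in> {1..n}" "i \<noteq> j" "i \<noteq> k" "i \<noteq> l"
  shows "expectation (\<lambda>\<omega>. \<xi> i \<omega> * \<xi> j \<omega> * (\<xi> k \<omega> * \<xi> l \<omega>)) = 0"
  unfolding four_product(2)[OF assms(1-4)]
  by (rule prod_zero) (use assms first_moment in \<open>auto intro!: bexI[of _ i]\<close>)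

lemma two_product:
  assumes "i \<in> {1..n}" "j \<in> {1..n}"
  shows "integrable M (\<lambda>\<omega>. \<xi> i \<omega> * \<xi> j \<omega>)"
    and "expectation (\<lambda>\<omega>. \<xi> i \<omega> * \<xi> j \<omega>) = (if i = j then 1 else 0)"
proof -
  define e where "e m = (of_bool (m = i) + of_bool (m = j) :: nat)" for m
  have eq: "(\<Prod>m=1..n. \<xi> m \<omega> ^ e m) = \<xi> i \<omega> * \<xi> j \<omega>" for \<omega>
    using assms by (simp add: e_def power_add prod.distrib prod_power_of_bool mult_ac del: One_nat_def atLeastAtMost_iff)
  have "e m \<le> 4" for m by (auto simp: e_def)
  note m = monomial[of e, OF this]
  show "integrable M (\<lambda>\<omega>. \<xi> i \<omega> * \<xi> j \<omega>)" using m(1) unfolding eq .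
  show "expectation (\<lambda>\<omega>. \<xi> i \<omega> * \<xi> j \<omega>) = (if i = j then 1 else 0)"
  proof (cases "i = j")
    case True then show ?thesis using second_moment[OF assms(1)] by (simp add: power2_eq_square)
  next
    case False
    then have "(\<Prod>m=1..n. expectation (\<lambda>\<omega>. \<xi> m \<omega> ^ e m)) = 0"
      by (intro prod_zero) (use assms first_moment in \<open>auto simp: e_def intro!: bexI[of _ i]\<close>)
    then show ?thesis using False m(2) unfolding eq by simp
  qed
qed

text \<open>For different pairs some index occurs only once among the four entries, and the case
  split finds it: the upper entry of \<open>p\<close> if the lower entries agree, the lower entry of
  \<open>q\<close> if the lower entry of \<open>p\<close> is the upper one of \<open>q\<close>, and
  the lower entry of \<open>p\<close> otherwise.\<close>

lemma off_diagonal_product: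
  fixes p q :: "nat \<times> nat"
  defines "P \<equiv> {(l, k). l \<in> {1..n} \<and> k \<in> {1..n} \<and> l < k}"
  assumes p: "p \<in> P" and q: "q \<in> P"
  shows "integrable M (\<lambda>\<omega>. \<xi> (fst p) \<omega> * \<xi> (snd p) \<omega> * (\<xi> (fst q) \<omega> * \<xi> (snd q) \<omega>))"
    and "expectation (\<lambda>\<omega>. \<xi> (fst p) \<omega> * \<xi> (snd p) \<omega> * (\<xi> (fst q) \<omega> * \<xi> (snd q) \<omega>)) = (if p = q then 1 else 0)"
proof -
  obtain i j k l where pq: "p = (i, j)" "q = (k, l)" by (cases p; cases q)
  have r: "i \<in> {1..n}" "j \<in> {1..n}" "k \<in> {1..n}" "l \<in> {1..n}" "i < j" "k < l"
    using p q by (auto simp: pq P_def)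
  show "integrable M (\<lambda>\<omega>. \<xi> (fst p) \<omega> * \<xi> (snd p) \<omega> * (\<xi> (fst q) \<omega> * \<xi> (snd q) \<omega>))"
    using four_product(1) r by (simp add: pq)
  show "expectation (\<lambda>\<omega>. \<xi> (fst p) \<omega> * \<xi> (snd p) \<omega> * (\<xi> (fst q) \<omega> * \<xi> (snd q) \<omega>)) = (if p = q then 1 else 0)"
  proof (cases "p = q")
    case True
    have "expectation (\<lambda>\<omega>. \<xi> m \<omega> ^ (of_bool (m = i) + of_bool (m = j) + of_bool (m = i) + of_bool (m = j))) = 1"
      if "m \<in> {1..n}" for m
      using that second_moment[of m] r by (auto simp: prob_space power2_eq_square)
    then show ?thesis using True four_product(2)[OF r(1,2,1,2)] by (simp add: pq)
  next
    case False
    show ?thesis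
    proof (cases "i = k")
      case True
      then have "expectation (\<lambda>\<omega>. \<xi> j \<omega> * \<xi> i \<omega> * (\<xi> k \<omega> * \<xi> l \<omega>)) = 0"
        using False r pq by (intro four_product_zero) auto
      then show ?thesis using False by (simp add: pq mult.commute)
    next
      case ik: False
      show ?thesis
      proof (cases "i = l")
        case True
        then have "expectation (\<lambda>\<omega>. \<xi> k \<omega> * \<xi> l \<omega> * (\<xi> i \<omega> * \<xi> j \<omega>)) = 0"
          using ik r by (intro four_product_zero) auto
        then show ?thesis using False by (simp add: pq mult.commute)
      next
        case il: False
        then have "expectation (\<lambda>\<omega>. \<xi> i \<omega> * \<xi> j \<omega> * (\<xi> k \<omega> * \<xi> l \<omega>)) = 0"
          using ik r by (intro four_product_zero) auto
        then show ?thesis using False by (simp add: pq)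
      qed
    qed
  qed
qed

lemma square_product:
  assumes "i \<in> {1..n}" "j \<in> {1..n}"
  shows "integrable M (\<lambda>\<omega>. ((\<xi> i \<omega>)\<^sup>2 - 1) * ((\<xi> j \<omega>)\<^sup>2 - 1))"
    and "expectation (\<lambda>\<omega>. ((\<xi> i \<omega>)\<^sup>2 - 1) * ((\<xi> j \<omega>)\<^sup>2 - 1)) = (if i = j then \<xi>s - 1 else 0)"
proof -
  have eq: "((\<xi> i \<omega>)\<^sup>2 - 1) * ((\<xi> j \<omega>)\<^sup>2 - 1)
      = \<xi> i \<omega> * \<xi> i \<omega> * (\<xi> j \<omega> * \<xi> j \<omega>) - (\<xi> i \<omega>)\<^sup>2 - (\<xi> j \<omega>)\<^sup>2 + 1" for \<omega>
    by (simp add: power2_eq_square algebra_simps)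
  note int = four_product(1)[OF assms(1,1) assms(2,2)] power_integrable[OF assms(1), of 2] power_integrable[OF assms(2), of 2]
  show "integrable M (\<lambda>\<omega>. ((\<xi> i \<omega>)\<^sup>2 - 1) * ((\<xi> j \<omega>)\<^sup>2 - 1))"
    unfolding eq using int by simp
  have 4: "expectation (\<lambda>\<omega>. \<xi> i \<omega> * \<xi> i \<omega> * (\<xi> j \<omega> * \<xi> j \<omega>)) = (if i = j then \<xi>s else 1)"
  proof (cases "i = j")
    case True
    then show ?thesis using fourth_moment[OF assms(2)] by (simp add: power4_eq_xxxx mult.assoc)
  next
    case False
    have "expectation (\<lambda>\<omega>. \<xi> m \<omega> ^ (of_bool (m = i) + of_bool (m = i) + of_bool (m = j) + of_bool (m = j))) = 1"
      if "m \<in> {1..n}" for m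
      using that second_moment[of m] False by (auto simp: prob_space power2_eq_square)
    then show ?thesis using False four_product(2)[OF assms(1,1) assms(2,2)] by simp
  qed
  show "expectation (\<lambda>\<omega>. ((\<xi> i \<omega>)\<^sup>2 - 1) * ((\<xi> j \<omega>)\<^sup>2 - 1)) = (if i = j then \<xi>s - 1 else 0)"
    unfolding eq using int by (simp add: 4 second_moment[OF assms(1)] second_moment[OF assms(2)] prob_space)
qed

end

section \<open>Error, cost and noise decomposition\<close>

text \<open>At the design points the smoother \<open>S_hat\<close> has this matrix divided by n;
  divided by n^2, it is the matrix of \<Sum> a_j z_j^2 as a quadratic form in the noise.\<close>

definition basis_kernel :: "nat \<Rightarrow> (nat \<Rightarrow> real) \<Rightarrow> nat \<Rightarrow> nat \<Rightarrow> real" where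
  "basis_kernel n a l k = (\<Sum>j=1..n. a j * trig_basis j (design n l) * trig_basis j (design n k))"

text \<open>Listing each unordered pair once makes the products \<xi>_l \<xi>_k orthonormal; the
  symmetric half is accounted for by the factor 2 in \<open>off_diagonal_part\<close>.\<close>

definition upper_pairs :: "nat \<Rightarrow> (nat \<times> nat) set" where
  "upper_pairs n = {(l, k). l \<in> {1..n} \<and> k \<in> {1..n} \<and> l < k}"

definition diagonal_part :: "nat \<Rightarrow> (nat \<Rightarrow> real) \<Rightarrow> (nat \<Rightarrow> real) \<Rightarrow> (nat \<Rightarrow> real) \<Rightarrow> real" where
  "diagonal_part n a s x = (\<Sum>l=1..n. (basis_kernel n a l l * (s l)\<^sup>2 / (real n)\<^sup>2) * ((x l)\<^sup>2 - 1))"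

definition off_diagonal_part :: "nat \<Rightarrow> (nat \<Rightarrow> real) \<Rightarrow> (nat \<Rightarrow> real) \<Rightarrow> (nat \<Rightarrow> real) \<Rightarrow> real" where
  "off_diagonal_part n a s x =
     (\<Sum>p\<in>upper_pairs n. (2 * basis_kernel n a (fst p) (snd p) * s (fst p) * s (snd p) / (real n)\<^sup>2)
        * (x (fst p) * x (snd p)))"

text \<open>The mean of \<Sum> a_j z_j^2 minus its ideal value \<Sum> a_j \<varsigma> / n. For odd n
  it vanishes at constant volatilities, by orthonormality; in general it measures how far \<phi>_j^2
  is from 1 at the design points.\<close>

definition variance_bias :: "nat \<Rightarrow> (nat \<Rightarrow> real) \<Rightarrow> (nat \<Rightarrow> real) \<Rightarrow> real" where
  "variance_bias n a s = (\<Sum>l=1..n. (basis_kernel n a l l - (\<Sum>j=1..n. a j)) * (s l)\<^sup>2) / (real n)\<^sup>2"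

text \<open>The integrand of \<open>risk\<close> with the observed vector as a free argument, so
  that volatilities and noise can be frozen separately.\<close>

definition empirical_error :: "nat \<Rightarrow> (real \<Rightarrow> real) \<Rightarrow> (nat \<Rightarrow> real) \<Rightarrow> (nat \<Rightarrow> real) \<Rightarrow> real" where
  "empirical_error n S y a = emp_norm_sq n (at_design n (\<lambda>x. S_hat n y a x - S x))"

lemma finite_upper_pairs [simp]: "finite (upper_pairs n)"
  by (rule finite_subset[of _ "{1..n} \<times> {1..n}"]) (auto simp: upper_pairs_def)

lemma sum_square_split:
  fixes f :: "nat \<Rightarrow> nat \<Rightarrow> real"
  assumes "\<And>l k. f l k = f k l"
  shows "(\<Sum>l=1..n. \<Sum>k=1..n. f l k) = (\<Sum>l=1..n. f l l) + 2 * (\<Sum>p\<in>upper_pairs n. f (fst p) (snd p))"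
proof -
  define g where "g p = f (fst p) (snd p)" for p
  define D where "D = (\<lambda>l. (l, l)) ` {1..n}"
  define L where "L = prod.swap ` upper_pairs n"
  have split: "{1..n} \<times> {1..n} = D \<union> upper_pairs n \<union> L"
    by (force simp: D_def L_def upper_pairs_def image_iff)
  have fin: "finite D" "finite L" "finite (upper_pairs n)" by (auto simp: D_def L_def)
  have "(\<Sum>l=1..n. \<Sum>k=1..n. f l k) = sum g ({1..n} \<times> {1..n})"
    by (simp add: sum.cartesian_product g_def case_prod_beta)
  also have "\<dots> = sum g D + sum g (upper_pairs n) + sum g L"
    unfolding split using fin by (subst sum.union_disjoint, auto simp: D_def L_def upper_pairs_def sum.union_disjoint)+
  also have "sum g D = (\<Sum>l=1..n. f l l)"
    unfolding D_def by (subst sum.reindex) (auto simp: inj_on_def g_def)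
  also have "sum g L = sum g (upper_pairs n)"
    unfolding L_def by (subst sum.reindex) (auto simp: inj_on_def g_def intro!: sum.cong assms)
  finally show ?thesis by (simp add: g_def)
qed

lemma theta_hat_add: "theta_hat n (\<lambda>l. u l + v l) j = theta_hat n u j + theta_hat n v j"
  by (simp add: theta_hat_def emp_inner_def ring_distribs sum.distrib)

lemma sum_theta_hat:
  "(\<Sum>j=1..n. a j * theta_hat n (\<lambda>l. s l * x l) j)
    = (\<Sum>l=1..n. (s l * (\<Sum>j=1..n. a j * trig_basis j (design n l)) / real n) * x l)"
proof -
  have "(\<Sum>j=1..n. a j * theta_hat n (\<lambda>l. s l * x l) j)
    = (\<Sum>j=1..n. \<Sum>l=1..n. s l * (a j * trig_basis j (design n l)) / real n * x l)"
    by (simp add: theta_hat_def emp_inner_def at_design_def sum_distrib_left mult_ac divide_inverse)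
  also have "\<dots> = (\<Sum>l=1..n. \<Sum>j=1..n. s l * (a j * trig_basis j (design n l)) / real n * x l)"
    by (rule sum.swap)
  finally show ?thesis
    by (simp add: sum_distrib_left sum_distrib_right sum_divide_distrib)
qed

lemma kernel_variance_eq:
  "(\<Sum>l=1..n. basis_kernel n a l l * (s l)\<^sup>2) / (real n)\<^sup>2
     = variance_bias n a s + (\<Sum>j=1..n. a j) * emp_norm_sq n s / real n"
  by (simp add: variance_bias_def emp_norm_sq_def emp_inner_def left_diff_distrib sum_subtractf
      sum_distrib_left[symmetric] power2_eq_square diff_divide_distrib)

text \<open>Subtracting 1 from each squared noise value centres the diagonal of the quadratic form.
  What is subtracted is its mean for standardized noise, which splits into bias and ideal
  value.\<close>

lemma sum_theta_hat_sq:
  "(\<Sum>j=1..n. a j * (theta_hat n (\<lambda>l. s l * x l) j)\<^sup>2)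
    = diagonal_part n a s x + off_diagonal_part n a s x + variance_bias n a s
      + (\<Sum>j=1..n. a j) * emp_norm_sq n s / real n"
proof -
  define f where "f l k = basis_kernel n a l k * s l * s k * x l * x k / (real n)\<^sup>2" for l k
  have "(\<Sum>j=1..n. a j * (theta_hat n (\<lambda>l. s l * x l) j)\<^sup>2)
     = (\<Sum>j=1..n. \<Sum>l=1..n. \<Sum>k=1..n. a j * trig_basis j (design n l) * trig_basis j (design n k)
          * s l * s k * x l * x k / (real n)\<^sup>2)"
    by (simp add: theta_hat_def emp_inner_def at_design_def power_mult_distrib power2_eq_square sum_product
        sum_distrib_left mult_ac divide_inverse)
  also have "\<dots> = (\<Sum>l=1..n. \<Sum>k=1..n. \<Sum>j=1..n. a j * trig_basis j (design n l) * trig_basis j (design n k)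
          * s l * s k * x l * x k / (real n)\<^sup>2)"
    by (subst sum.swap) (intro sum.cong refl sum.swap)
  also have "\<dots> = (\<Sum>l=1..n. \<Sum>k=1..n. f l k)"
    by (simp add: f_def basis_kernel_def sum_distrib_right sum_divide_distrib)
  also have "\<dots> = (\<Sum>l=1..n. f l l) + 2 * (\<Sum>p\<in>upper_pairs n. f (fst p) (snd p))"
    by (rule sum_square_split) (simp add: f_def basis_kernel_def mult_ac)
  also have "2 * (\<Sum>p\<in>upper_pairs n. f (fst p) (snd p)) = off_diagonal_part n a s x"
    by (simp add: off_diagonal_part_def f_def sum_distrib_left mult_ac)
  also have "(\<Sum>l=1..n. f l l) = diagonal_part n a s x + (\<Sum>l=1..n. basis_kernel n a l l * (s l)\<^sup>2) / (real n)\<^sup>2"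
    by (simp add: diagonal_part_def f_def sum_divide_distrib sum.distrib[symmetric] power2_eq_square field_simps)
  also note kernel_variance_eq
  finally show ?thesis by simp
qed

section \<open>Parseval identities on the design, and the error in Fourier coordinates\<close>

locale odd_design =
  fixes n :: nat
  assumes odd_n: "odd n"
begin

lemma n_pos [simp]: "0 < n"
  using odd_n by (cases n) auto

lemma sum_expansion_times_basis:
  assumes "j \<in> {1..n}"
  shows "(\<Sum>l=1..n. (\<Sum>i=1..n. a i * trig_basis i (design n l)) * trig_basis j (design n l)) = real n * a j"
proof -
  have "(\<Sum>l=1..n. (\<Sum>i=1..n. a i * trig_basis i (design n l)) * trig_basis j (design n l))
    = (\<Sum>i=1..n. a i * (\<Sum>l=1..n. trig_basis i (design n l) * trig_basis j (design n l)))"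
    unfolding sum_distrib_left sum_distrib_right by (subst sum.swap) (simp add: mult_ac)
  also have "\<dots> = (\<Sum>i=1..n. if i = j then real n * a j else 0)"
    using sum_trig_basis_orthogonal[OF odd_n _ assms] by (intro sum.cong refl) simp
  finally show ?thesis using assms by simp
qed

lemma sum_sq_expansion:
  "(\<Sum>l=1..n. (\<Sum>j=1..n. a j * trig_basis j (design n l))\<^sup>2) = real n * (\<Sum>j=1..n. (a j)\<^sup>2)"
proof -
  have "(\<Sum>l=1..n. (\<Sum>j=1..n. a j * trig_basis j (design n l))\<^sup>2)
    = (\<Sum>l=1..n. \<Sum>j=1..n. a j * ((\<Sum>i=1..n. a i * trig_basis i (design n l)) * trig_basis j (design n l)))"
    by (simp add: power2_eq_square sum_distrib_left mult_ac)
  also have "\<dots> = (\<Sum>j=1..n. a j * (\<Sum>l=1..n. (\<Sum>i=1..n. a i * trig_basis i (design n l)) * trig_basis j (design n l)))"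
    by (subst sum.swap) (simp add: sum_distrib_left)
  also have "\<dots> = (\<Sum>j=1..n. a j * (real n * a j))"
    by (intro sum.cong refl) (simp add: sum_expansion_times_basis del: One_nat_def)
  finally show ?thesis by (simp add: sum_distrib_left power2_eq_square mult_ac)
qed

text \<open>Parseval for a row of the kernel, whose Fourier coefficients are a_j \<phi>_j(x_l). It
  turns the second moment of the off-diagonal part into a form with weights a_j^2, the source of
  |a|^2 and u_{2,n} in its bound.\<close>

lemma sum_basis_kernel_sq:
  "(\<Sum>k=1..n. (basis_kernel n a l k)\<^sup>2) = real n * basis_kernel n (\<lambda>j. (a j)\<^sup>2) l l"
  unfolding basis_kernel_def using sum_sq_expansion[of "\<lambda>j. a j * trig_basis j (design n l)"]
  by (simp add: power_mult_distrib power2_eq_square mult_ac)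

lemma emp_norm_sq_expansion_diff:
  "emp_norm_sq n (\<lambda>l. (\<Sum>j=1..n. a j * trig_basis j (design n l)) - u l)
    = (\<Sum>j=1..n. (a j)\<^sup>2) - 2 * (\<Sum>j=1..n. a j * theta_hat n u j) + emp_norm_sq n u"
proof -
  define g where "g l = (\<Sum>j=1..n. a j * trig_basis j (design n l))" for l
  have cross: "(\<Sum>l=1..n. g l * u l) = real n * (\<Sum>j=1..n. a j * theta_hat n u j)"
  proof -
    have "(\<Sum>l=1..n. g l * u l) = (\<Sum>l=1..n. \<Sum>j=1..n. a j * (u l * trig_basis j (design n l)))"
      by (simp add: g_def sum_distrib_left sum_distrib_right mult_ac)
    also have "\<dots> = (\<Sum>j=1..n. a j * (\<Sum>l=1..n. u l * trig_basis j (design n l)))"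
      by (subst sum.swap) (simp add: sum_distrib_left)
    finally show ?thesis
      by (simp add: theta_hat_def emp_inner_def at_design_def sum_distrib_left)
  qed
  have "(\<Sum>l=1..n. (g l - u l) * (g l - u l)) = (\<Sum>l=1..n. (g l)\<^sup>2) - 2 * (\<Sum>l=1..n. g l * u l) + (\<Sum>l=1..n. u l * u l)"
    by (simp add: power2_eq_square algebra_simps sum.distrib sum_subtractf sum_distrib_left)
  also have "(\<Sum>l=1..n. (g l)\<^sup>2) = real n * (\<Sum>j=1..n. (a j)\<^sup>2)"
    unfolding g_def by (rule sum_sq_expansion)
  finally show ?thesis
    unfolding emp_norm_sq_def emp_inner_def g_def[symmetric] cross by (simp only:) (simp add: field_simps)
qed

lemma empirical_error_eq:
  "empirical_error n S y a = (\<Sum>j=1..n. (a j * theta_hat n y j)\<^sup>2)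
     - 2 * (\<Sum>j=1..n. a j * theta_hat n y j * theta_hat n (at_design n S) j) + emp_norm_sq n (at_design n S)"
  using emp_norm_sq_expansion_diff[of "\<lambda>j. a j * theta_hat n y j" "at_design n S"]
  by (simp add: empirical_error_def at_design_def[abs_def] S_hat_def)

text \<open>The squared distance between \<open>u\<close> and its expansion is nonnegative.\<close>

lemma bessel: "(\<Sum>j=1..n. (theta_hat n u j)\<^sup>2) \<le> emp_norm_sq n u"
proof -
  have "0 \<le> emp_norm_sq n (\<lambda>l. (\<Sum>j=1..n. theta_hat n u j * trig_basis j (design n l)) - u l)"
    by (simp add: emp_norm_sq_def emp_inner_def sum_nonneg)
  then show ?thesis unfolding emp_norm_sq_expansion_diff by (simp add: power2_eq_square)
qed

text \<open>Both sides have the same quadratic and cross terms, so the claim reduces to Bessel's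
  inequality for the signal.\<close>

lemma empirical_error_ge:
  "(\<Sum>j=1..n. (a j * theta_hat n y j - theta_hat n (at_design n S) j)\<^sup>2) \<le> empirical_error n S y a"
  using bessel[of "at_design n S"] unfolding empirical_error_eq
  by (simp add: power2_diff sum.distrib sum_subtractf sum_distrib_left mult_ac)

text \<open>The cross product of \<open>theta_hat\<close> with the true coefficient is unknown, and
  the cost has \<open>theta_tilde\<close> in its place. Writing \<open>theta_hat\<close> as signal
  plus noise in its square leaves exactly the listed noise terms, the centring with \<open>c\<close>
  and the penalty.\<close>

lemma empirical_error_cost:
  assumes y: "\<And>l. y l = at_design n S l + w l"
  shows "empirical_error n S y a = cost n \<rho> y c a + emp_norm_sq n (at_design n S)
     + 2 * (\<Sum>j=1..n. a j * theta_hat n (at_design n S) j * theta_hat n w j)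
     + 2 * (\<Sum>j=1..n. a j * (theta_hat n w j)\<^sup>2)
     - 2 * (\<Sum>j=1..n. a j) * c / real n - \<rho> * (\<Sum>j=1..n. (a j)\<^sup>2) * c / real n"
proof -
  have t: "theta_hat n y j = theta_hat n (at_design n S) j + theta_hat n w j" for j
    unfolding theta_hat_add[symmetric] y ..
  have "(\<Sum>j=1..n. a j * theta_tilde n y c j) = (\<Sum>j=1..n. a j * (theta_hat n y j)\<^sup>2) - (\<Sum>j=1..n. a j) * c / real n"
    by (simp add: theta_tilde_def right_diff_distrib sum_subtractf sum_distrib_right sum_divide_distrib)
  moreover have "(\<Sum>j=1..n. a j * (theta_hat n y j)\<^sup>2)
     = (\<Sum>j=1..n. a j * theta_hat n y j * theta_hat n (at_design n S) j)
       + (\<Sum>j=1..n. a j * theta_hat n (at_design n S) j * theta_hat n w j)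
       + (\<Sum>j=1..n. a j * (theta_hat n w j)\<^sup>2)"
    unfolding sum.distrib[symmetric] t by (simp add: power2_eq_square algebra_simps)
  ultimately show ?thesis
    unfolding empirical_error_eq cost_def penalty_def weight_norm_sq_def power_mult_distrib
      times_divide_eq_right[symmetric] mult.assoc[symmetric] by argo
qed

end

section \<open>Moment bounds for fixed volatilities\<close>

text \<open>For \<open>N = 0\<close> the quotient is 0 by convention, and the second assumption
  makes the left side vanish too.\<close>

lemma young_quotient:
  fixes m N t :: real
  assumes "0 \<le> N" "N = 0 \<Longrightarrow> m = 0" "0 < t"
  shows "2 * \<bar>m\<bar> \<le> t * N + m\<^sup>2 / (t * N)"
proof (cases "N = 0")
  case False
  with assms have p: "0 < t * N" by simp
  have "2 * \<bar>m\<bar> * (t * N) \<le> (t * N)\<^sup>2 + m\<^sup>2"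
    using sum_squares_bound[of "\<bar>m\<bar>" "t * N"] by (simp add: mult_ac)
  then have "2 * \<bar>m\<bar> \<le> ((t * N)\<^sup>2 + m\<^sup>2) / (t * N)"
    using p by (simp add: pos_le_divide_eq)
  also have "\<dots> = t * N + m\<^sup>2 / (t * N)"
    using p by (simp add: add_divide_distrib power2_eq_square)
  finally show ?thesis .
qed (use assms in auto)

text \<open>Here the volatilities are a deterministic vector, the value of the random ones at a
  fixed outcome.\<close>

locale bounded_volatility = odd_design n for n :: nat +
  fixes s :: "nat \<Rightarrow> real" and \<sigma>s :: real
  assumes volatility_pos: "l \<in> {1..n} \<Longrightarrow> 0 < s l"
    and volatility_bound: "l \<in> {1..n} \<Longrightarrow> (s l)\<^sup>2 \<le> \<sigma>s"
begin

lemma \<sigma>s_nonneg: "0 \<le> \<sigma>s"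
  using volatility_bound[of 1] n_pos by (simp add: order_trans[OF zero_le_power2])

lemma variance_bias_bound:
  assumes "\<And>l. l \<in> {1..n} \<Longrightarrow> \<bar>basis_kernel n a l l - (\<Sum>j=1..n. a j)\<bar> \<le> u"
  shows "\<bar>variance_bias n a s\<bar> \<le> u * \<sigma>s / real n"
proof -
  have u: "0 \<le> u" using assms[of 1] n_pos by (auto intro: order_trans[OF abs_ge_zero])
  have "\<bar>\<Sum>l=1..n. (basis_kernel n a l l - (\<Sum>j=1..n. a j)) * (s l)\<^sup>2\<bar> \<le> (\<Sum>l=1..n. u * \<sigma>s)"
    using assms volatility_bound u
    by (intro order_trans[OF sum_abs] sum_mono) (auto simp: abs_mult intro!: mult_mono)
  then have "\<bar>\<Sum>l=1..n. (basis_kernel n a l l - (\<Sum>j=1..n. a j)) * (s l)\<^sup>2\<bar> / (real n)\<^sup>2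
      \<le> (\<Sum>l=1..n. u * \<sigma>s) / (real n)\<^sup>2"
    by (rule divide_right_mono) simp
  then have "\<bar>variance_bias n a s\<bar> \<le> (real n * (u * \<sigma>s)) / (real n)\<^sup>2"
    unfolding variance_bias_def abs_divide by simp
  then show ?thesis using n_pos by (simp add: power2_eq_square split: if_splits)
qed

end

locale heteroscedastic_design = bounded_volatility n s \<sigma>s + standardized_noise M n \<xi> \<xi>s
  for n :: nat and s :: "nat \<Rightarrow> real" and \<sigma>s :: real
    and M :: "'a measure" and \<xi> :: "nat \<Rightarrow> 'a \<Rightarrow> real" and \<xi>s :: real
begin

text \<open>The variance of \<xi>_1^2 is \<open>\<xi>s - 1\<close>.\<close>

lemma \<xi>s_ge_1: "1 \<le> \<xi>s"
proof -
  have "0 \<le> expectation (\<lambda>\<omega>. ((\<xi> 1 \<omega>)\<^sup>2 - 1) * ((\<xi> 1 \<omega>)\<^sup>2 - 1))"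
    by (intro integral_nonneg_AE AE_I2) simp
  then show ?thesis using square_product(2)[of 1 1] n_pos by (simp del: One_nat_def)
qed

abbreviation noise_coeff :: "'a \<Rightarrow> nat \<Rightarrow> real" where
  "noise_coeff \<omega> \<equiv> theta_hat n (\<lambda>l. s l * \<xi> l \<omega>)"

text \<open>The form is a combination of orthonormal noise variables. Bounding the squared
  volatilities by \<open>\<sigma>s\<close> leaves the squared norm of \<Sum> a_j \<phi>_j, which
  Parseval computes.\<close>

lemma linear_noise:
  shows "integrable M (\<lambda>\<omega>. (\<Sum>j=1..n. a j * noise_coeff \<omega> j)\<^sup>2)"
    and "expectation (\<lambda>\<omega>. (\<Sum>j=1..n. a j * noise_coeff \<omega> j)\<^sup>2) \<le> \<sigma>s / real n * (\<Sum>j=1..n. (a j)\<^sup>2)"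
    and "integrable M (\<lambda>\<omega>. \<Sum>j=1..n. a j * noise_coeff \<omega> j)"
    and "expectation (\<lambda>\<omega>. \<Sum>j=1..n. a j * noise_coeff \<omega> j) = 0"
proof -
  let ?g = "\<lambda>l. \<Sum>j=1..n. a j * trig_basis j (design n l)"
  note o = expectation_sq_sum_orthogonal[where I = "{1..n}" and Z = \<xi>, OF two_product finite_atLeastAtMost]
  show "integrable M (\<lambda>\<omega>. (\<Sum>j=1..n. a j * noise_coeff \<omega> j)\<^sup>2)"
    unfolding sum_theta_hat by (rule o(1))
  have "expectation (\<lambda>\<omega>. (\<Sum>j=1..n. a j * noise_coeff \<omega> j)\<^sup>2) = (\<Sum>l=1..n. (s l * ?g l / real n)\<^sup>2)"
    unfolding sum_theta_hat by (subst o(2)) simp_all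
  also have "\<dots> \<le> (\<Sum>l=1..n. \<sigma>s * (?g l)\<^sup>2 / (real n)\<^sup>2)"
    by (intro sum_mono) (auto simp: power_mult_distrib power_divide intro!: divide_right_mono mult_right_mono volatility_bound)
  also have "\<dots> = \<sigma>s / (real n)\<^sup>2 * (\<Sum>l=1..n. (?g l)\<^sup>2)"
    by (simp add: sum_distrib_left)
  also have "\<dots> = \<sigma>s / real n * (\<Sum>j=1..n. (a j)\<^sup>2)"
    unfolding sum_sq_expansion by (simp add: power2_eq_square)
  finally show "expectation (\<lambda>\<omega>. (\<Sum>j=1..n. a j * noise_coeff \<omega> j)\<^sup>2) \<le> \<sigma>s / real n * (\<Sum>j=1..n. (a j)\<^sup>2)" .
  have int: "l \<in> {1..n} \<Longrightarrow> integrable M (\<xi> l)" for l using power_integrable[of l 1] by simp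
  show "integrable M (\<lambda>\<omega>. \<Sum>j=1..n. a j * noise_coeff \<omega> j)"
    unfolding sum_theta_hat using int by (intro Bochner_Integration.integrable_sum integrable_mult_right) auto
  have "expectation (\<lambda>\<omega>. \<Sum>j=1..n. a j * noise_coeff \<omega> j) = (\<Sum>l=1..n. (s l * ?g l / real n) * expectation (\<xi> l))"
    unfolding sum_theta_hat using int by (subst Bochner_Integration.integral_sum) auto
  also have "\<dots> = 0" using first_moment by (intro sum.neutral) auto
  finally show "expectation (\<lambda>\<omega>. \<Sum>j=1..n. a j * noise_coeff \<omega> j) = 0" .
qed

text \<open>There are n orthogonal terms with coefficients of order 1 / n^2, so the second moment is
  of order 1 / n^3. With \<open>C\<close> equal to u_{1,n} + v_n this is the origin of the terms
  with \<open>sqrt \<xi>s / sqrt (real n)\<close> in \<open>Upsilon_star\<close>.\<close>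

lemma diagonal_part_bound:
  assumes K: "\<And>l. l \<in> {1..n} \<Longrightarrow> \<bar>basis_kernel n a l l\<bar> \<le> C"
  shows "integrable M (\<lambda>\<omega>. \<bar>diagonal_part n a s (\<lambda>l. \<xi> l \<omega>)\<bar>)"
    and "expectation (\<lambda>\<omega>. \<bar>diagonal_part n a s (\<lambda>l. \<xi> l \<omega>)\<bar>) \<le> C * \<sigma>s * sqrt \<xi>s / (real n * sqrt (real n))"
proof -
  let ?D = "\<lambda>\<omega>. diagonal_part n a s (\<lambda>l. \<xi> l \<omega>)"
  let ?c = "\<lambda>l. basis_kernel n a l l * (s l)\<^sup>2 / (real n)\<^sup>2"
  have C: "0 \<le> C" using K[of 1] n_pos by (auto intro: order_trans[OF abs_ge_zero])
  note o = expectation_sq_sum_orthogonal[where I = "{1..n}" and Z = "\<lambda>i \<omega>. (\<xi> i \<omega>)\<^sup>2 - 1", OF square_product finite_atLeastAtMost]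
  have sq: "integrable M (\<lambda>\<omega>. (?D \<omega>)\<^sup>2)"
    unfolding diagonal_part_def by (rule o(1))
  have [measurable]: "?D \<in> borel_measurable M"
    unfolding diagonal_part_def by measurable
  have "integrable M ?D"
    by (rule square_integrable_imp_integrable[OF _ sq]) measurable
  then show int: "integrable M (\<lambda>\<omega>. \<bar>?D \<omega>\<bar>)" by simp
  \<comment> \<open>The variance of the absolute value is nonnegative.\<close>
  have "(expectation (\<lambda>\<omega>. \<bar>?D \<omega>\<bar>))\<^sup>2 \<le> expectation (\<lambda>\<omega>. (?D \<omega>)\<^sup>2)"
    using variance_positive[of "\<lambda>\<omega>. \<bar>?D \<omega>\<bar>"] variance_eq[OF int] sq by simp
  also have "\<dots> = (\<xi>s - 1) * (\<Sum>l=1..n. (?c l)\<^sup>2)"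
    unfolding diagonal_part_def by (rule o(2))
  also have "\<dots> \<le> \<xi>s * (\<Sum>l=1..n. (C * \<sigma>s / (real n)\<^sup>2)\<^sup>2)"
  proof (intro mult_mono sum_mono)
    fix l assume l: "l \<in> {1..n}"
    have "\<bar>?c l\<bar> \<le> C * \<sigma>s / (real n)\<^sup>2"
      using K[OF l] volatility_bound[OF l] C
      by (auto simp: abs_mult intro!: divide_right_mono mult_mono)
    then show "(?c l)\<^sup>2 \<le> (C * \<sigma>s / (real n)\<^sup>2)\<^sup>2" by (metis abs_le_square_iff abs_ge_self order_trans)
  qed (use \<xi>s_ge_1 in \<open>auto intro: sum_nonneg\<close>)
  also have "\<dots> = (C * \<sigma>s * sqrt \<xi>s / (real n * sqrt (real n)))\<^sup>2"
    using \<xi>s_ge_1 by (simp add: power_mult_distrib power_divide) (simp add: power2_eq_square power4_eq_xxxx mult_ac)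
  finally show "expectation (\<lambda>\<omega>. \<bar>?D \<omega>\<bar>) \<le> C * \<sigma>s * sqrt \<xi>s / (real n * sqrt (real n))"
    by (rule power2_le_imp_le) (use C \<sigma>s_nonneg \<xi>s_ge_1 in simp)
qed

text \<open>Of the two squared volatilities in each term only one is replaced by its bound. Keeping
  the other makes the bound a multiple of the mean of \<Sum> a_j^2 z_j^2, which is close to the
  actual penalty.\<close>

lemma off_diagonal_part_moments:
  shows "integrable M (\<lambda>\<omega>. (off_diagonal_part n a s (\<lambda>l. \<xi> l \<omega>))\<^sup>2)"
    and "expectation (\<lambda>\<omega>. (off_diagonal_part n a s (\<lambda>l. \<xi> l \<omega>))\<^sup>2)
      \<le> 2 * \<sigma>s / real n * ((\<Sum>l=1..n. basis_kernel n (\<lambda>j. (a j)\<^sup>2) l l * (s l)\<^sup>2) / (real n)\<^sup>2)"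
proof -
  let ?c = "\<lambda>p. 2 * basis_kernel n a (fst p) (snd p) * s (fst p) * s (snd p) / (real n)\<^sup>2"
  define f where "f l k = (basis_kernel n a l k * s l * s k / (real n)\<^sup>2)\<^sup>2" for l k
  note o = expectation_sq_sum_orthogonal[where I = "upper_pairs n" and Z = "\<lambda>p \<omega>. \<xi> (fst p) \<omega> * \<xi> (snd p) \<omega>",
      OF off_diagonal_product[folded upper_pairs_def] finite_upper_pairs]
  show "integrable M (\<lambda>\<omega>. (off_diagonal_part n a s (\<lambda>l. \<xi> l \<omega>))\<^sup>2)"
    unfolding off_diagonal_part_def by (rule o(1))
  have "expectation (\<lambda>\<omega>. (off_diagonal_part n a s (\<lambda>l. \<xi> l \<omega>))\<^sup>2) = (\<Sum>p\<in>upper_pairs n. (?c p)\<^sup>2)"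
    unfolding off_diagonal_part_def by (subst o(2)) simp_all
  also have "\<dots> = 4 * (\<Sum>p\<in>upper_pairs n. f (fst p) (snd p))"
    by (simp add: f_def sum_distrib_left power_mult_distrib power_divide mult_ac)
  \<comment> \<open>Twice the upper triangle is at most the full array, whose rows Parseval can
    sum.\<close>
  also have "\<dots> \<le> 2 * (\<Sum>l=1..n. \<Sum>k=1..n. f l k)"
    by (subst sum_square_split) (auto simp: f_def basis_kernel_def mult_ac intro: sum_nonneg)
  also have "\<dots> \<le> 2 * (\<Sum>l=1..n. \<Sum>k=1..n. \<sigma>s * (s l)\<^sup>2 / (real n) ^ 4 * (basis_kernel n a l k)\<^sup>2)"
  proof -
    have "f l k \<le> \<sigma>s * (s l)\<^sup>2 / (real n) ^ 4 * (basis_kernel n a l k)\<^sup>2" if "k \<in> {1..n}" for l k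
    proof -
      have "f l k = (s k)\<^sup>2 * ((s l)\<^sup>2 / (real n) ^ 4 * (basis_kernel n a l k)\<^sup>2)"
        by (simp add: f_def power_mult_distrib power_divide)
      also have "\<dots> \<le> \<sigma>s * ((s l)\<^sup>2 / (real n) ^ 4 * (basis_kernel n a l k)\<^sup>2)"
        by (intro mult_right_mono volatility_bound that) simp
      finally show ?thesis by simp
    qed
    then show ?thesis by (intro mult_left_mono sum_mono) auto
  qed
  also have "\<dots> = 2 * (\<Sum>l=1..n. \<sigma>s * (s l)\<^sup>2 / (real n) ^ 4 * (real n * basis_kernel n (\<lambda>j. (a j)\<^sup>2) l l))"
    by (simp only: sum_basis_kernel_sq sum_distrib_left[symmetric])
  also have "\<dots> = 2 * \<sigma>s / real n * ((\<Sum>l=1..n. basis_kernel n (\<lambda>j. (a j)\<^sup>2) l l * (s l)\<^sup>2) / (real n)\<^sup>2)"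
    by (simp add: sum_distrib_left sum_divide_distrib power4_eq_xxxx power2_eq_square mult_ac)
  finally show "expectation (\<lambda>\<omega>. (off_diagonal_part n a s (\<lambda>l. \<xi> l \<omega>))\<^sup>2)
      \<le> 2 * \<sigma>s / real n * ((\<Sum>l=1..n. basis_kernel n (\<lambda>j. (a j)\<^sup>2) l l * (s l)\<^sup>2) / (real n)\<^sup>2)" .
qed

lemma off_diagonal_part_bound:
  assumes "\<And>l. l \<in> {1..n} \<Longrightarrow> \<bar>basis_kernel n (\<lambda>j. (a j)\<^sup>2) l l - (\<Sum>j=1..n. (a j)\<^sup>2)\<bar> \<le> u"
  shows "expectation (\<lambda>\<omega>. (off_diagonal_part n a s (\<lambda>l. \<xi> l \<omega>))\<^sup>2)
    \<le> 2 * \<sigma>s / real n * (((\<Sum>j=1..n. (a j)\<^sup>2) * emp_norm_sq n s + u * \<sigma>s) / real n)"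
proof -
  have "variance_bias n (\<lambda>j. (a j)\<^sup>2) s \<le> u * \<sigma>s / real n"
    using variance_bias_bound[OF assms] by simp
  then have "(\<Sum>l=1..n. basis_kernel n (\<lambda>j. (a j)\<^sup>2) l l * (s l)\<^sup>2) / (real n)\<^sup>2
    \<le> ((\<Sum>j=1..n. (a j)\<^sup>2) * emp_norm_sq n s + u * \<sigma>s) / real n"
    unfolding kernel_variance_eq by (simp add: add_divide_distrib)
  then show ?thesis
    using off_diagonal_part_moments(2)[of a] \<sigma>s_nonneg
    by (elim order_trans) (intro mult_left_mono; simp)
qed

lemma expected_sq_noise_coeff:
  shows "integrable M (\<lambda>\<omega>. \<Sum>j=1..n. a j * (noise_coeff \<omega> j)\<^sup>2)"
    and "expectation (\<lambda>\<omega>. \<Sum>j=1..n. a j * (noise_coeff \<omega> j)\<^sup>2) = (\<Sum>l=1..n. basis_kernel n a l l * (s l)\<^sup>2) / (real n)\<^sup>2"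
proof -
  have single: "noise_coeff \<omega> j = (\<Sum>l=1..n. (s l * trig_basis j (design n l) / real n) * \<xi> l \<omega>)" for \<omega> j
    by (simp add: theta_hat_def emp_inner_def at_design_def sum_distrib_left mult_ac)
  note o = expectation_sq_sum_orthogonal[where I = "{1..n}" and Z = \<xi>, OF two_product finite_atLeastAtMost]
  have int: "integrable M (\<lambda>\<omega>. (noise_coeff \<omega> j)\<^sup>2)" for j
    unfolding single by (rule o(1))
  have e: "expectation (\<lambda>\<omega>. (noise_coeff \<omega> j)\<^sup>2) = (\<Sum>l=1..n. (s l * trig_basis j (design n l) / real n)\<^sup>2)" for j
    unfolding single by (subst o(2)) simp_all
  show "integrable M (\<lambda>\<omega>. \<Sum>j=1..n. a j * (noise_coeff \<omega> j)\<^sup>2)"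
    using int by (intro Bochner_Integration.integrable_sum integrable_mult_right)
  have "expectation (\<lambda>\<omega>. \<Sum>j=1..n. a j * (noise_coeff \<omega> j)\<^sup>2)
     = (\<Sum>j=1..n. \<Sum>l=1..n. a j * (s l * trig_basis j (design n l) / real n)\<^sup>2)"
    using int by (simp add: Bochner_Integration.integral_sum e sum_distrib_left)
  also have "\<dots> = (\<Sum>l=1..n. \<Sum>j=1..n. a j * (s l * trig_basis j (design n l) / real n)\<^sup>2)"
    by (rule sum.swap)
  also have "\<dots> = (\<Sum>l=1..n. basis_kernel n a l l * (s l)\<^sup>2) / (real n)\<^sup>2"
    by (simp add: basis_kernel_def sum_distrib_left sum_divide_distrib power_mult_distrib power_divide power2_eq_square mult_ac)
  finally show "expectation (\<lambda>\<omega>. \<Sum>j=1..n. a j * (noise_coeff \<omega> j)\<^sup>2) = (\<Sum>l=1..n. basis_kernel n a l l * (s l)\<^sup>2) / (real n)\<^sup>2" .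
qed

text \<open>The error dominates a random variable whose mean is |a|^2 \<varsigma> / n up to the
  variance bias; this is how the penalty of the competitor is charged to its own risk.\<close>

lemma weighted_variance_le_risk:
  assumes u: "\<And>l. l \<in> {1..n} \<Longrightarrow> \<bar>basis_kernel n (\<lambda>j. (a j)\<^sup>2) l l - (\<Sum>j=1..n. (a j)\<^sup>2)\<bar> \<le> u"
  shows "ennreal ((\<Sum>j=1..n. (a j)\<^sup>2) * emp_norm_sq n s / real n)
    \<le> (\<integral>\<^sup>+\<omega>. ennreal (empirical_error n S (\<lambda>l. at_design n S l + s l * \<xi> l \<omega>) a) \<partial>M) + ennreal (u * \<sigma>s / real n)"
proof -
  let ?\<theta> = "theta_hat n (at_design n S)"
  \<comment> \<open>What remains of the sum of squares in \<open>empirical_error_ge\<close> after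
    dropping the squares of the deterministic biases (a_j - 1) \<theta>_j; the part linear in the
    noise has mean 0.\<close>
  define X where "X \<omega> = 2 * (\<Sum>j=1..n. ((a j - 1) * ?\<theta> j * a j) * noise_coeff \<omega> j)
      + (\<Sum>j=1..n. (a j)\<^sup>2 * (noise_coeff \<omega> j)\<^sup>2)" for \<omega>
  have int: "integrable M X"
    unfolding X_def using linear_noise(3) expected_sq_noise_coeff(1)[of "\<lambda>j. (a j)\<^sup>2"] by (intro Bochner_Integration.integrable_add integrable_mult_right) auto
  have "expectation X = expectation (\<lambda>\<omega>. \<Sum>j=1..n. (a j)\<^sup>2 * (noise_coeff \<omega> j)\<^sup>2)"
    unfolding X_def using linear_noise(3,4) expected_sq_noise_coeff(1)[of "\<lambda>j. (a j)\<^sup>2"] by simp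
  also have "\<dots> = variance_bias n (\<lambda>j. (a j)\<^sup>2) s + (\<Sum>j=1..n. (a j)\<^sup>2) * emp_norm_sq n s / real n"
    by (rule trans[OF expected_sq_noise_coeff(2) kernel_variance_eq])
  finally have "(\<Sum>j=1..n. (a j)\<^sup>2) * emp_norm_sq n s / real n \<le> expectation X + u * \<sigma>s / real n"
    using variance_bias_bound[OF u] by simp
  moreover have "0 \<le> u"
    using u[of 1] n_pos by (auto intro: order_trans[OF abs_ge_zero])
  ultimately have "ennreal ((\<Sum>j=1..n. (a j)\<^sup>2) * emp_norm_sq n s / real n) \<le> ennreal (expectation X) + ennreal (u * \<sigma>s / real n)"
    using \<sigma>s_nonneg by (cases "0 \<le> expectation X") (auto simp: ennreal_plus[symmetric] ennreal_neg intro!: ennreal_leI simp del: ennreal_plus)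
  \<comment> \<open>\<open>ennreal\<close> sends negative values of \<open>X\<close> to 0, so the
    right side is the integral of the positive part.\<close>
  also have "ennreal (expectation X) \<le> (\<integral>\<^sup>+\<omega>. ennreal (X \<omega>) \<partial>M)"
  proof -
    have "ennreal (expectation X) \<le> ennreal (expectation (\<lambda>\<omega>. max 0 (X \<omega>)))"
      using int by (intro ennreal_leI integral_mono) auto
    also have "\<dots> = (\<integral>\<^sup>+\<omega>. ennreal (max 0 (X \<omega>)) \<partial>M)"
      using int by (subst nn_integral_eq_integral) auto
    finally show ?thesis by (simp add: ennreal_max_0)
  qed
  also have "\<dots> \<le> (\<integral>\<^sup>+\<omega>. ennreal (empirical_error n S (\<lambda>l. at_design n S l + s l * \<xi> l \<omega>) a) \<partial>M)"
  proof (intro nn_integral_mono ennreal_leI)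
    fix \<omega>
    let ?y = "\<lambda>l. at_design n S l + s l * \<xi> l \<omega>"
    have "X \<omega> \<le> (\<Sum>j=1..n. (a j * theta_hat n ?y j - ?\<theta> j)\<^sup>2)"
      unfolding X_def sum_distrib_left sum.distrib[symmetric]
    proof (intro sum_mono)
      fix j
      have "(a j * theta_hat n ?y j - ?\<theta> j)\<^sup>2 = ((a j - 1) * ?\<theta> j)\<^sup>2
          + (2 * ((a j - 1) * ?\<theta> j * a j * noise_coeff \<omega> j) + (a j)\<^sup>2 * (noise_coeff \<omega> j)\<^sup>2)"
        unfolding theta_hat_add by (simp add: power2_eq_square algebra_simps)
      then show "2 * ((a j - 1) * ?\<theta> j * a j * noise_coeff \<omega> j) + (a j)\<^sup>2 * (noise_coeff \<omega> j)\<^sup>2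
         \<le> (a j * theta_hat n ?y j - ?\<theta> j)\<^sup>2" by simp
    qed
    also have "\<dots> \<le> empirical_error n S ?y a" by (rule empirical_error_ge)
    finally show "X \<omega> \<le> empirical_error n S ?y a" .
  qed
  finally show ?thesis by simp
qed

end

section \<open>The pointwise oracle inequality\<close>

text \<open>
  In both remainders a vanishing denominator forces the numerator to vanish, so the convention
  \<open>x / 0 = 0\<close> does no harm.
\<close>

definition linear_remainder ::
  "nat \<Rightarrow> real \<Rightarrow> (nat \<Rightarrow> real) \<Rightarrow> (nat \<Rightarrow> real) \<Rightarrow> (nat \<Rightarrow> real) \<Rightarrow> (nat \<Rightarrow> real) \<Rightarrow> real" where
  "linear_remainder n \<rho> \<theta> \<mu> s x =
     (\<Sum>j=1..n. (\<mu> j * \<theta> j) * theta_hat n (\<lambda>l. s l * x l) j)\<^sup>2 / (\<rho> * (\<Sum>j=1..n. (\<mu> j * \<theta> j)\<^sup>2))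
     + (\<Sum>j=1..n. ((\<mu> j)\<^sup>2 * \<theta> j) * theta_hat n (\<lambda>l. s l * x l) j)\<^sup>2 / ((1 - \<rho>) * (\<Sum>j=1..n. (\<mu> j * \<theta> j)\<^sup>2))"

text \<open>\<open>U\<close> will be u_{2,n} \<open>\<sigma>s\<close>, which bounds n times the
  variance bias of the squared weights. With this choice the second moment of the off-diagonal part
  is at most 2 \<open>\<sigma>s\<close> / n times this quantity.\<close>

definition inflated_penalty :: "nat \<Rightarrow> real \<Rightarrow> (nat \<Rightarrow> real) \<Rightarrow> (nat \<Rightarrow> real) \<Rightarrow> real" where
  "inflated_penalty n U a s = ((\<Sum>j=1..n. (a j)\<^sup>2) * emp_norm_sq n s + U) / real n"

definition quadratic_remainder ::
  "nat \<Rightarrow> real \<Rightarrow> real \<Rightarrow> (nat \<Rightarrow> real) \<Rightarrow> (nat \<Rightarrow> real) \<Rightarrow> (nat \<Rightarrow> real) \<Rightarrow> real" where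
  "quadratic_remainder n \<rho> U a s x =
     2 * \<bar>diagonal_part n a s x\<bar> + 4 / \<rho> * ((off_diagonal_part n a s x)\<^sup>2 / inflated_penalty n U a s)"

lemma emp_norm_sq_nonneg: "0 \<le> emp_norm_sq n u"
  by (simp add: emp_norm_sq_def emp_inner_def sum_nonneg)

lemma inflated_penalty_nonneg: "0 \<le> U \<Longrightarrow> 0 \<le> inflated_penalty n U a s"
  unfolding inflated_penalty_def
  by (intro divide_nonneg_nonneg add_nonneg_nonneg mult_nonneg_nonneg sum_nonneg emp_norm_sq_nonneg) auto

section \<open>Pathwise bounds for one volatility vector and one noise vector\<close>

context bounded_volatility
begin

lemma emp_norm_sq_volatility_pos: "0 < emp_norm_sq n s"
proof -
  have "0 < (\<Sum>l=1..n. s l * s l)"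
    by (rule sum_pos) (use volatility_pos n_pos in \<open>auto simp: Suc_le_eq\<close>)
  then show ?thesis by (simp add: emp_norm_sq_def emp_inner_def)
qed

text \<open>As the volatilities are positive, a vanishing denominator forces all weights to
  vanish.\<close>

lemma off_diagonal_part_eq_0:
  assumes "0 \<le> U" "inflated_penalty n U a s = 0"
  shows "off_diagonal_part n a s x = 0"
proof -
  have "0 \<le> (\<Sum>j=1..n. (a j)\<^sup>2) * emp_norm_sq n s"
    using emp_norm_sq_volatility_pos by (intro mult_nonneg_nonneg sum_nonneg) auto
  moreover have "(\<Sum>j=1..n. (a j)\<^sup>2) * emp_norm_sq n s + U = 0"
    using assms(2) n_pos by (simp add: inflated_penalty_def)
  ultimately have "(\<Sum>j=1..n. (a j)\<^sup>2) * emp_norm_sq n s = 0"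
    using assms(1) by linarith
  then have "(\<Sum>j=1..n. (a j)\<^sup>2) = 0"
    using emp_norm_sq_volatility_pos by simp
  then have "\<forall>j\<in>{1..n}. a j = 0"
    by (simp add: sum_nonneg_eq_0_iff)
  then have "basis_kernel n a l k = 0" for l k
    by (auto simp: basis_kernel_def intro!: sum.neutral)
  then show ?thesis by (simp add: off_diagonal_part_def)
qed

text \<open>Young's parameter is \<rho> / 4: for the minimizer a quarter stays below the penalty
  \<rho> |a|^2 \<varsigma> / n of the cost, and the reciprocal 4 / \<rho> leads to the summand 16
  \<nu> / \<rho> of \<open>Upsilon_star\<close>.\<close>

lemma quadratic_noise_bound:
  assumes "0 < \<rho>" "0 \<le> U"
    and u: "\<And>l. l \<in> {1..n} \<Longrightarrow> \<bar>basis_kernel n a l l - (\<Sum>j=1..n. a j)\<bar> \<le> u"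
  shows "2 * \<bar>(\<Sum>j=1..n. a j * (theta_hat n (\<lambda>l. s l * x l) j)\<^sup>2) - (\<Sum>j=1..n. a j) * emp_norm_sq n s / real n\<bar>
    \<le> quadratic_remainder n \<rho> U a s x + 2 * (u * \<sigma>s / real n) + \<rho> / 4 * inflated_penalty n U a s"
proof -
  have "2 * \<bar>off_diagonal_part n a s x\<bar> \<le> \<rho> / 4 * inflated_penalty n U a s
      + (off_diagonal_part n a s x)\<^sup>2 / (\<rho> / 4 * inflated_penalty n U a s)"
    using assms off_diagonal_part_eq_0 by (intro young_quotient inflated_penalty_nonneg) auto
  then have "2 * \<bar>off_diagonal_part n a s x\<bar> \<le> \<rho> / 4 * inflated_penalty n U a s
      + 4 / \<rho> * ((off_diagonal_part n a s x)\<^sup>2 / inflated_penalty n U a s)"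
    by simp
  moreover have "\<bar>variance_bias n a s\<bar> \<le> u * \<sigma>s / real n"
    by (rule variance_bias_bound[OF u])
  moreover have "\<bar>d + e + b + t - t\<bar> \<le> \<bar>d\<bar> + \<bar>e\<bar> + \<bar>b\<bar>" for d e b t :: real
    by linarith
  ultimately show ?thesis
    unfolding sum_theta_hat_sq quadratic_remainder_def by (smt (verit))
qed

text \<open>\<open>N\<close> contains the true coefficients, whereas the errors control the observed
  ones. Expanding the observed version and dropping the square of the noise leaves \<open>N\<close>
  plus twice the linear term \<open>m1\<close>. Young's inequality for \<open>m1\<close> takes back
  only \<rho> \<open>N\<close>, hence (1 - \<rho>) \<open>N\<close> is bounded by the errors and a
  quotient.\<close>

lemma linear_noise_bound:
  fixes S a b x
  defines "y \<equiv> \<lambda>l. at_design n S l + s l * x l"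
    and "\<theta> \<equiv> theta_hat n (at_design n S)"
  assumes \<rho>: "0 < \<rho>" "\<rho> < 1"
  shows "2 * (\<Sum>j=1..n. (a j - b j) * \<theta> j * theta_hat n (\<lambda>l. s l * x l) j)
    \<le> \<rho> / (1 - \<rho>) * (2 * empirical_error n S y a + 2 * empirical_error n S y b)
      + linear_remainder n \<rho> \<theta> (\<lambda>j. a j - b j) s x"
proof -
  define z where "z = theta_hat n (\<lambda>l. s l * x l)"
  define N where "N = (\<Sum>j=1..n. ((a j - b j) * \<theta> j)\<^sup>2)"
  define m where "m = (\<Sum>j=1..n. ((a j - b j) * \<theta> j) * z j)"
  define m1 where "m1 = (\<Sum>j=1..n. ((a j - b j)\<^sup>2 * \<theta> j) * z j)"
  have ty: "theta_hat n y j = \<theta> j + z j" for j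
    unfolding y_def \<theta>_def z_def by (rule theta_hat_add)
  have N: "0 \<le> N" by (auto simp: N_def intro: sum_nonneg)
  have N0: "(a j - b j) * \<theta> j = 0" if "N = 0" "j \<in> {1..n}" for j
    using that unfolding N_def by (simp add: sum_nonneg_eq_0_iff)
  have m0: "m = 0" if "N = 0"
    unfolding m_def using N0[OF that] by (intro sum.neutral) auto
  have m10: "m1 = 0" if "N = 0"
    unfolding m1_def using N0[OF that] by (intro sum.neutral) (auto simp: power2_eq_square)
  have ym: "2 * \<bar>m\<bar> \<le> \<rho> * N + m\<^sup>2 / (\<rho> * N)"
    using N m0 \<rho> by (intro young_quotient) auto
  have ym1: "2 * \<bar>m1\<bar> \<le> \<rho> * N + m1\<^sup>2 / (\<rho> * N)"
    using N m10 \<rho> by (intro young_quotient) auto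
  have "N + 2 * m1 \<le> (\<Sum>j=1..n. ((a j - b j) * theta_hat n y j)\<^sup>2)"
    unfolding N_def m1_def sum_distrib_left sum.distrib[symmetric]
  proof (intro sum_mono)
    fix j
    have "((a j - b j) * theta_hat n y j)\<^sup>2
        = ((a j - b j) * \<theta> j)\<^sup>2 + 2 * ((a j - b j)\<^sup>2 * \<theta> j * z j) + ((a j - b j) * z j)\<^sup>2"
      unfolding ty by (simp add: power2_eq_square algebra_simps)
    then show "((a j - b j) * \<theta> j)\<^sup>2 + 2 * ((a j - b j)\<^sup>2 * \<theta> j * z j) \<le> ((a j - b j) * theta_hat n y j)\<^sup>2"
      by simp
  qed
  \<comment> \<open>The coefficient is the difference of the coefficientwise errors of
    \<open>a\<close> and \<open>b\<close>, and (p - q)^2 \<le> 2 p^2 + 2 q^2.\<close>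
  also have "\<dots> \<le> 2 * (\<Sum>j=1..n. (a j * theta_hat n y j - \<theta> j)\<^sup>2) + 2 * (\<Sum>j=1..n. (b j * theta_hat n y j - \<theta> j)\<^sup>2)"
    unfolding sum_distrib_left sum.distrib[symmetric]
  proof (intro sum_mono)
    fix j
    have "0 \<le> ((a j * theta_hat n y j - \<theta> j) + (b j * theta_hat n y j - \<theta> j))\<^sup>2" by simp
    then show "((a j - b j) * theta_hat n y j)\<^sup>2 \<le> 2 * (a j * theta_hat n y j - \<theta> j)\<^sup>2 + 2 * (b j * theta_hat n y j - \<theta> j)\<^sup>2"
      by (simp add: power2_eq_square algebra_simps)
  qed
  also have "\<dots> \<le> 2 * empirical_error n S y a + 2 * empirical_error n S y b"
    unfolding \<theta>_def by (intro add_mono mult_left_mono empirical_error_ge) auto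
  finally have "(1 - \<rho>) * N \<le> 2 * empirical_error n S y a + 2 * empirical_error n S y b + m1\<^sup>2 / (\<rho> * N)"
    using ym1 by (simp add: algebra_simps)
  \<comment> \<open>This factor reproduces the \<rho> \<open>N\<close> left over from the inequality
    for \<open>m\<close>, and turns the quotient of \<open>m1\<close> into the second summand of
    \<open>linear_remainder\<close>.\<close>
  then have "\<rho> / (1 - \<rho>) * ((1 - \<rho>) * N)
      \<le> \<rho> / (1 - \<rho>) * (2 * empirical_error n S y a + 2 * empirical_error n S y b + m1\<^sup>2 / (\<rho> * N))"
    by (rule mult_left_mono) (use \<rho> in simp)
  moreover have "\<rho> / (1 - \<rho>) * ((1 - \<rho>) * N) = \<rho> * N" using \<rho> by simp
  moreover have "\<rho> / (1 - \<rho>) * (m1\<^sup>2 / (\<rho> * N)) = m1\<^sup>2 / ((1 - \<rho>) * N)" using \<rho> by simp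
  ultimately have "2 * m \<le> \<rho> / (1 - \<rho>) * (2 * empirical_error n S y a + 2 * empirical_error n S y b)
      + (m\<^sup>2 / (\<rho> * N) + m1\<^sup>2 / ((1 - \<rho>) * N))"
    using ym unfolding distrib_left by linarith
  then show ?thesis
    unfolding linear_remainder_def m_def m1_def N_def z_def .
qed

text \<open>In the difference of the cost identities for \<open>a\<close> and \<open>b\<close>,
  minimality removes the costs, and \<open>c\<close> is exchanged for the true
  \<open>\<zeta>\<close>. The quadratic noise uses a quarter of the penalty of \<open>a\<close>; the
  remaining three quarters have a favourable sign and are dropped. For \<open>b\<close> the quarter
  adds to its penalty, giving 5/4 \<rho>.\<close>

lemma pointwise_oracle_inequality:
  fixes S a b x
  defines "y \<equiv> \<lambda>l. at_design n S l + s l * x l"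
    and "\<theta> \<equiv> theta_hat n (at_design n S)"
    and "\<zeta> \<equiv> emp_norm_sq n s"
  assumes \<rho>: "0 < \<rho>" "\<rho> < 1" and U: "0 \<le> U"
    and cost: "cost n \<rho> y c a \<le> cost n \<rho> y c b"
    and a01: "\<And>j. j \<in> {1..n} \<Longrightarrow> 0 \<le> a j \<and> a j \<le> 1" and b01: "\<And>j. j \<in> {1..n} \<Longrightarrow> 0 \<le> b j \<and> b j \<le> 1"
    and av: "(\<Sum>j=1..n. a j) \<le> v" and bv: "(\<Sum>j=1..n. b j) \<le> v"
    and au: "\<And>l. l \<in> {1..n} \<Longrightarrow> \<bar>basis_kernel n a l l - (\<Sum>j=1..n. a j)\<bar> \<le> u"
    and bu: "\<And>l. l \<in> {1..n} \<Longrightarrow> \<bar>basis_kernel n b l l - (\<Sum>j=1..n. b j)\<bar> \<le> u"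
  shows "(1 - 3 * \<rho>) / (1 - \<rho>) * empirical_error n S y a
    \<le> (1 + \<rho>) / (1 - \<rho>) * empirical_error n S y b + 5 / 4 * \<rho> * ((\<Sum>j=1..n. (b j)\<^sup>2) * \<zeta> / real n)
      + (linear_remainder n \<rho> \<theta> (\<lambda>j. a j - b j) s x + quadratic_remainder n \<rho> U a s x + quadratic_remainder n \<rho> U b s x)
      + 4 * (u * \<sigma>s / real n) + \<rho> / 2 * (U / real n) + (2 + \<rho>) * (v * \<bar>c - \<zeta>\<bar> / real n)"
proof -
  define E F where "E = empirical_error n S y a" and "F = empirical_error n S y b"
  define A B where "A = (\<Sum>j=1..n. (a j)\<^sup>2)" and "B = (\<Sum>j=1..n. (b j)\<^sup>2)"
  define L K where "L = (\<Sum>j=1..n. a j)" and "K = (\<Sum>j=1..n. b j)"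
  define z where "z = theta_hat n (\<lambda>l. s l * x l)"
  define T R where "T = (\<Sum>j=1..n. a j * (z j)\<^sup>2)" and "R = (\<Sum>j=1..n. b j * (z j)\<^sup>2)"
  define m where "m = (\<Sum>j=1..n. (a j - b j) * \<theta> j * z j)"
  have m: "m = (\<Sum>j=1..n. a j * \<theta> j * z j) - (\<Sum>j=1..n. b j * \<theta> j * z j)"
    by (simp add: m_def left_diff_distrib sum_subtractf)
  \<comment> \<open>Weights in [0,1] satisfy |a|^2 \<le> \<Sum> a_j \<le> v, so v also controls the
    error in the penalty.\<close>
  have sq: "\<And>t::real. 0 \<le> t \<and> t \<le> 1 \<Longrightarrow> t\<^sup>2 \<le> t" by (simp add: power2_eq_square mult_left_le)
  have AL: "0 \<le> A" "A \<le> L" "0 \<le> L" and BK: "0 \<le> B" "B \<le> K" "0 \<le> K"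
    unfolding A_def L_def B_def K_def using a01 b01 sq by (auto intro!: sum_nonneg sum_mono)
  have \<zeta>: "0 < \<zeta>" unfolding \<zeta>_def by (rule emp_norm_sq_volatility_pos)
  have Ee: "E = cost n \<rho> y c a + emp_norm_sq n (at_design n S) + 2 * (\<Sum>j=1..n. a j * \<theta> j * z j) + 2 * T
      - 2 * L * c / real n - \<rho> * A * c / real n"
    unfolding E_def \<theta>_def z_def T_def L_def A_def by (rule empirical_error_cost) (simp add: y_def)
  have Fe: "F = cost n \<rho> y c b + emp_norm_sq n (at_design n S) + 2 * (\<Sum>j=1..n. b j * \<theta> j * z j) + 2 * R
      - 2 * K * c / real n - \<rho> * B * c / real n"
    unfolding F_def \<theta>_def z_def R_def K_def B_def by (rule empirical_error_cost) (simp add: y_def)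
  have mb: "2 * m \<le> \<rho> / (1 - \<rho>) * (2 * E + 2 * F) + linear_remainder n \<rho> \<theta> (\<lambda>j. a j - b j) s x"
    unfolding m_def E_def F_def \<theta>_def y_def z_def by (rule linear_noise_bound[OF \<rho>])
  have Tb: "2 * \<bar>T - L * \<zeta> / real n\<bar> \<le> quadratic_remainder n \<rho> U a s x + 2 * (u * \<sigma>s / real n) + \<rho> / 4 * ((A * \<zeta> + U) / real n)"
    using quadratic_noise_bound[OF \<rho>(1) U au] unfolding T_def L_def A_def \<zeta>_def z_def inflated_penalty_def .
  have Rb: "2 * \<bar>R - K * \<zeta> / real n\<bar> \<le> quadratic_remainder n \<rho> U b s x + 2 * (u * \<sigma>s / real n) + \<rho> / 4 * ((B * \<zeta> + U) / real n)"
    using quadratic_noise_bound[OF \<rho>(1) U bu] unfolding R_def K_def B_def \<zeta>_def z_def inflated_penalty_def .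
  \<comment> \<open>The price of using \<open>c\<close> in place of \<open>\<zeta>\<close>: 2 from
    the centring and \<rho> from the penalty.\<close>
  have "(2 * (L - K) + \<rho> * (A - B)) * (\<zeta> - c) \<le> \<bar>2 * (L - K) + \<rho> * (A - B)\<bar> * \<bar>c - \<zeta>\<bar>"
    by (metis abs_ge_self abs_minus_commute abs_mult)
  also have "\<dots> \<le> ((2 + \<rho>) * v) * \<bar>c - \<zeta>\<bar>"
  proof (rule mult_right_mono)
    have "\<bar>L - K\<bar> \<le> v" "\<bar>A - B\<bar> \<le> v" using AL BK av bv unfolding L_def[symmetric] K_def[symmetric] by linarith+
    then have "\<rho> * \<bar>A - B\<bar> \<le> \<rho> * v" using \<rho> by (intro mult_left_mono) auto
    moreover have "\<bar>2 * (L - K) + \<rho> * (A - B)\<bar> \<le> 2 * \<bar>L - K\<bar> + \<rho> * \<bar>A - B\<bar>"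
      using abs_triangle_ineq[of "2 * (L - K)" "\<rho> * (A - B)"] \<rho> unfolding abs_mult by simp
    ultimately show "\<bar>2 * (L - K) + \<rho> * (A - B)\<bar> \<le> (2 + \<rho>) * v"
      using \<open>\<bar>L - K\<bar> \<le> v\<close> by (simp add: algebra_simps)
  qed simp
  finally have cb: "(2 * (L - K) + \<rho> * (A - B)) * (\<zeta> - c) / real n \<le> (2 + \<rho>) * (v * \<bar>c - \<zeta>\<bar> / real n)"
    using n_pos by (simp add: divide_right_mono)
  have cid: "(2 * (L - K) + \<rho> * (A - B)) * (\<zeta> - c) / real n
      = 2 * (L * \<zeta> / real n) - 2 * (K * \<zeta> / real n) + \<rho> * (A * \<zeta> / real n) - \<rho> * (B * \<zeta> / real n)
        - 2 * L * c / real n + 2 * K * c / real n - \<rho> * A * c / real n + \<rho> * B * c / real n"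
    using n_pos by (simp add: field_simps)
  have A\<zeta>: "0 \<le> \<rho> * (A * \<zeta> / real n)" using \<rho> AL \<zeta> by simp
  have Q: "(A * \<zeta> + U) / real n = A * \<zeta> / real n + U / real n" "(B * \<zeta> + U) / real n = B * \<zeta> / real n + U / real n"
    by (simp_all add: add_divide_distrib)
  have absT: "T - L * \<zeta> / real n \<le> \<bar>T - L * \<zeta> / real n\<bar>" and absR: "K * \<zeta> / real n - R \<le> \<bar>R - K * \<zeta> / real n\<bar>"
    by (simp_all add: abs_le_iff)
  have "E \<le> F + 2 * m + 2 * \<bar>T - L * \<zeta> / real n\<bar> + 2 * \<bar>R - K * \<zeta> / real n\<bar>
      + (2 * (L - K) + \<rho> * (A - B)) * (\<zeta> - c) / real n - \<rho> * (A * \<zeta> / real n) + \<rho> * (B * \<zeta> / real n)"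
    unfolding cid Ee Fe m using cost absT absR by argo
  then have *: "E - \<rho> / (1 - \<rho>) * (2 * E + 2 * F) \<le> F + 5 / 4 * \<rho> * (B * \<zeta> / real n)
      + (linear_remainder n \<rho> \<theta> (\<lambda>j. a j - b j) s x + quadratic_remainder n \<rho> U a s x + quadratic_remainder n \<rho> U b s x)
      + 4 * (u * \<sigma>s / real n) + \<rho> / 2 * (U / real n) + (2 + \<rho>) * (v * \<bar>c - \<zeta>\<bar> / real n)"
    using mb Tb Rb cb A\<zeta> unfolding Q distrib_left by argo
  \<comment> \<open>The share 2 \<rho> / (1 - \<rho>) of each error, spent on the linear noise, is
    moved to the left for \<open>a\<close> and stays on the right for \<open>b\<close>.\<close>
  have "(1 - 3 * \<rho>) / (1 - \<rho>) = 1 - 2 * (\<rho> / (1 - \<rho>))" "(1 + \<rho>) / (1 - \<rho>) = 1 + 2 * (\<rho> / (1 - \<rho>))"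
    using \<rho> by (simp_all add: field_simps)
  then have "(1 - 3 * \<rho>) / (1 - \<rho>) * E - (1 + \<rho>) / (1 - \<rho>) * F = E - \<rho> / (1 - \<rho>) * (2 * E + 2 * F) - F"
    by (simp only:) (simp add: algebra_simps)
  with * show ?thesis unfolding E_def[symmetric] F_def[symmetric] B_def[symmetric] by linarith
qed

end

section \<open>Expected remainders for a fixed volatility vector\<close>

context heteroscedastic_design
begin

text \<open>Each squared linear form has mean at most \<open>\<sigma>s\<close> / n times the sum in
  its denominator, so the signal cancels and the bound is uniform in \<open>\<theta>\<close>. The
  two quotients contribute 1 / \<rho> + 1 / (1 - \<rho>).\<close>

lemma linear_remainder_bound:
  assumes \<rho>: "0 < \<rho>" "\<rho> < 1" and \<mu>: "\<And>j. j \<in> {1..n} \<Longrightarrow> \<bar>\<mu> j\<bar> \<le> 1"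
  shows "integrable M (\<lambda>\<omega>. linear_remainder n \<rho> \<theta> \<mu> s (\<lambda>l. \<xi> l \<omega>))"
    and "expectation (\<lambda>\<omega>. linear_remainder n \<rho> \<theta> \<mu> s (\<lambda>l. \<xi> l \<omega>)) \<le> \<sigma>s / (real n * (\<rho> * (1 - \<rho>)))"
proof -
  let ?N = "\<Sum>j=1..n. (\<mu> j * \<theta> j)\<^sup>2"
  let ?m = "\<lambda>\<omega>. (\<Sum>j=1..n. (\<mu> j * \<theta> j) * noise_coeff \<omega> j)\<^sup>2"
  let ?k = "\<lambda>\<omega>. (\<Sum>j=1..n. ((\<mu> j)\<^sup>2 * \<theta> j) * noise_coeff \<omega> j)\<^sup>2"
  show int: "integrable M (\<lambda>\<omega>. linear_remainder n \<rho> \<theta> \<mu> s (\<lambda>l. \<xi> l \<omega>))"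
    unfolding linear_remainder_def using linear_noise(1) by (intro Bochner_Integration.integrable_add integrable_divide)
  have N: "0 \<le> ?N" by (intro sum_nonneg) auto
  have ratio: "e / (t * ?N) \<le> \<sigma>s / real n / t" if "e \<le> \<sigma>s / real n * ?N" "0 < t" for e t
  proof (cases "?N = 0")
    case True then show ?thesis using that \<sigma>s_nonneg by (simp only: mult_zero_right div_by_0) simp
  next
    case False
    then have "e / (t * ?N) \<le> (\<sigma>s / real n * ?N) / (t * ?N)"
      using N that by (intro divide_right_mono) auto
    then show ?thesis using False by simp
  qed
  have k: "expectation ?k \<le> \<sigma>s / real n * ?N"
  proof -
    have "(\<Sum>j=1..n. ((\<mu> j)\<^sup>2 * \<theta> j)\<^sup>2) \<le> ?N"
    proof (rule sum_mono)
      fix j assume "j \<in> {1..n}"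
      then have "(\<mu> j)\<^sup>2 \<le> 1" using \<mu> by (simp add: abs_square_le_1)
      then have "(\<mu> j)\<^sup>2 * ((\<mu> j)\<^sup>2 * (\<theta> j)\<^sup>2) \<le> 1 * ((\<mu> j)\<^sup>2 * (\<theta> j)\<^sup>2)" by (rule mult_right_mono) simp
      then show "((\<mu> j)\<^sup>2 * \<theta> j)\<^sup>2 \<le> (\<mu> j * \<theta> j)\<^sup>2" by (simp add: power_mult_distrib power2_eq_square mult_ac)
    qed
    then have "\<sigma>s / real n * (\<Sum>j=1..n. ((\<mu> j)\<^sup>2 * \<theta> j)\<^sup>2) \<le> \<sigma>s / real n * ?N"
      using \<sigma>s_nonneg by (intro mult_left_mono) auto
    then show ?thesis using linear_noise(2)[of "\<lambda>j. (\<mu> j)\<^sup>2 * \<theta> j"] by linarith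
  qed
  have "expectation (\<lambda>\<omega>. linear_remainder n \<rho> \<theta> \<mu> s (\<lambda>l. \<xi> l \<omega>))
      = expectation ?m / (\<rho> * ?N) + expectation ?k / ((1 - \<rho>) * ?N)"
    unfolding linear_remainder_def using linear_noise(1)
    by (subst Bochner_Integration.integral_add) auto
  also have "\<dots> \<le> \<sigma>s / real n / \<rho> + \<sigma>s / real n / (1 - \<rho>)"
    using \<rho> by (intro add_mono ratio linear_noise(2) k) auto
  also have "\<dots> = \<sigma>s / (real n * (\<rho> * (1 - \<rho>)))"
    using \<rho> n_pos by (simp add: field_simps)
  finally show "expectation (\<lambda>\<omega>. linear_remainder n \<rho> \<theta> \<mu> s (\<lambda>l. \<xi> l \<omega>)) \<le> \<sigma>s / (real n * (\<rho> * (1 - \<rho>)))" .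
qed

text \<open>The denominator depends on the volatilities only, so it is a constant here, and it
  matches the second moment of the off-diagonal part. The diagonal of the kernel is at most
  \<open>u + v\<close>, which brings u_{1,n} and v_n together.\<close>

lemma quadratic_remainder_bound:
  assumes \<rho>: "0 < \<rho>" and a0: "\<And>j. j \<in> {1..n} \<Longrightarrow> 0 \<le> a j" and v: "(\<Sum>j=1..n. a j) \<le> v"
    and u: "\<And>l. l \<in> {1..n} \<Longrightarrow> \<bar>basis_kernel n a l l - (\<Sum>j=1..n. a j)\<bar> \<le> u"
    and u2: "\<And>l. l \<in> {1..n} \<Longrightarrow> \<bar>basis_kernel n (\<lambda>j. (a j)\<^sup>2) l l - (\<Sum>j=1..n. (a j)\<^sup>2)\<bar> \<le> u2"
  shows "integrable M (\<lambda>\<omega>. quadratic_remainder n \<rho> (u2 * \<sigma>s) a s (\<lambda>l. \<xi> l \<omega>))"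
    and "expectation (\<lambda>\<omega>. quadratic_remainder n \<rho> (u2 * \<sigma>s) a s (\<lambda>l. \<xi> l \<omega>))
      \<le> 2 * ((u + v) * \<sigma>s * sqrt \<xi>s / (real n * sqrt (real n))) + 4 / \<rho> * (2 * \<sigma>s / real n)"
proof -
  let ?Q = "inflated_penalty n (u2 * \<sigma>s) a s"
  have K: "\<bar>basis_kernel n a l l\<bar> \<le> u + v" if "l \<in> {1..n}" for l
    using u[OF that] v sum_nonneg[of "{1..n}" a, OF a0] by linarith
  have "0 \<le> u2" using u2[of 1] n_pos by (auto intro: order_trans[OF abs_ge_zero])
  then have Q: "0 \<le> ?Q" using \<sigma>s_nonneg by (intro inflated_penalty_nonneg) auto
  note d = diagonal_part_bound[of a, OF K] and o = off_diagonal_part_moments(1)[of a]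
  show "integrable M (\<lambda>\<omega>. quadratic_remainder n \<rho> (u2 * \<sigma>s) a s (\<lambda>l. \<xi> l \<omega>))"
    unfolding quadratic_remainder_def using d(1) o
    by (intro Bochner_Integration.integrable_add integrable_mult_right integrable_divide)
  have eq: "expectation (\<lambda>\<omega>. quadratic_remainder n \<rho> (u2 * \<sigma>s) a s (\<lambda>l. \<xi> l \<omega>))
     = 2 * expectation (\<lambda>\<omega>. \<bar>diagonal_part n a s (\<lambda>l. \<xi> l \<omega>)\<bar>)
       + 4 / \<rho> * (expectation (\<lambda>\<omega>. (off_diagonal_part n a s (\<lambda>l. \<xi> l \<omega>))\<^sup>2) / ?Q)"
    unfolding quadratic_remainder_def using d(1) o
    by (subst Bochner_Integration.integral_add) (auto intro: integrable_mult_right integrable_divide)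
  have "expectation (\<lambda>\<omega>. (off_diagonal_part n a s (\<lambda>l. \<xi> l \<omega>))\<^sup>2) / ?Q \<le> (2 * \<sigma>s / real n * ?Q) / ?Q"
    using off_diagonal_part_bound[OF u2] Q unfolding inflated_penalty_def by (intro divide_right_mono) auto
  also have "\<dots> \<le> 2 * \<sigma>s / real n"
    using \<sigma>s_nonneg by (cases "?Q = 0") auto
  finally have "4 / \<rho> * (expectation (\<lambda>\<omega>. (off_diagonal_part n a s (\<lambda>l. \<xi> l \<omega>))\<^sup>2) / ?Q)
      \<le> 4 / \<rho> * (2 * \<sigma>s / real n)"
    by (rule mult_left_mono) (use \<rho> in simp)
  then show "expectation (\<lambda>\<omega>. quadratic_remainder n \<rho> (u2 * \<sigma>s) a s (\<lambda>l. \<xi> l \<omega>))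
      \<le> 2 * ((u + v) * \<sigma>s * sqrt \<xi>s / (real n * sqrt (real n))) + 4 / \<rho> * (2 * \<sigma>s / real n)"
    unfolding eq using d(2) by linarith
qed

end

section \<open>Integration over the volatilities\<close>

text \<open>Independence makes the joint law of \<open>X\<close> and \<open>Y\<close> a product, and
  Tonelli's theorem applies; in the inner integral \<open>X\<close> is frozen.\<close>

lemma (in prob_space) nn_integral_indep_var:
  assumes ind: "indep_var N1 X N2 Y" and f: "f \<in> borel_measurable (N1 \<Otimes>\<^sub>M N2)"
  shows "(\<integral>\<^sup>+\<omega>. f (X \<omega>, Y \<omega>) \<partial>M) = (\<integral>\<^sup>+\<omega>. (\<integral>\<^sup>+\<omega>'. f (X \<omega>, Y \<omega>') \<partial>M) \<partial>M)"
proof -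
  have X [measurable]: "X \<in> measurable M N1" and Y [measurable]: "Y \<in> measurable M N2"
    and eq: "distr M N1 X \<Otimes>\<^sub>M distr M N2 Y = distr M (N1 \<Otimes>\<^sub>M N2) (\<lambda>\<omega>. (X \<omega>, Y \<omega>))"
    using ind unfolding indep_var_distribution_eq by auto
  interpret Y: prob_space "distr M N2 Y" by (rule prob_space_distr) fact
  note f [measurable]
  have m: "(\<lambda>x. \<integral>\<^sup>+y. f (x, y) \<partial>distr M N2 Y) \<in> borel_measurable N1"
    by (rule Y.borel_measurable_nn_integral_fst[of _ N1]) simp
  have "(\<integral>\<^sup>+\<omega>. f (X \<omega>, Y \<omega>) \<partial>M) = integral\<^sup>N (distr M N1 X \<Otimes>\<^sub>M distr M N2 Y) f"
    unfolding eq by (subst nn_integral_distr) auto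
  also have "\<dots> = (\<integral>\<^sup>+x. \<integral>\<^sup>+y. f (x, y) \<partial>distr M N2 Y \<partial>distr M N1 X)"
    by (rule Y.nn_integral_fst[symmetric]) simp
  also have "\<dots> = (\<integral>\<^sup>+\<omega>. (\<integral>\<^sup>+y. f (X \<omega>, y) \<partial>distr M N2 Y) \<partial>M)"
    using m by (subst nn_integral_distr) auto
  also have "\<dots> = (\<integral>\<^sup>+\<omega>. (\<integral>\<^sup>+\<omega>'. f (X \<omega>, Y \<omega>') \<partial>M) \<partial>M)"
    by (intro nn_integral_cong nn_integral_distr) (auto dest: measurable_space)
  finally show ?thesis .
qed

section \<open>Measurability, and dependence on the coordinates 1 to n only\<close>

lemma borel_measurable_emp_inner:
  assumes "\<And>l. l \<in> {1..n} \<Longrightarrow> (\<lambda>p. f p l) \<in> borel_measurable N" "\<And>l. l \<in> {1..n} \<Longrightarrow> (\<lambda>p. g p l) \<in> borel_measurable N"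
  shows "(\<lambda>p. emp_inner n (f p) (g p)) \<in> borel_measurable N"
  unfolding emp_inner_def using assms by (intro borel_measurable_times borel_measurable_sum) auto

lemma borel_measurable_theta_hat:
  assumes "\<And>l. l \<in> {1..n} \<Longrightarrow> (\<lambda>p. f p l) \<in> borel_measurable N"
  shows "(\<lambda>p. theta_hat n (f p) j) \<in> borel_measurable N"
  unfolding theta_hat_def by (intro borel_measurable_emp_inner assms borel_measurable_const)

lemma borel_measurable_empirical_error:
  assumes "\<And>l. l \<in> {1..n} \<Longrightarrow> (\<lambda>p. f p l) \<in> borel_measurable N"
  shows "(\<lambda>p. empirical_error n S (f p) a) \<in> borel_measurable N"
  unfolding empirical_error_def emp_norm_sq_def at_design_def S_hat_def
  by (intro borel_measurable_emp_inner borel_measurable_diff borel_measurable_sum borel_measurable_times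
      borel_measurable_theta_hat assms borel_measurable_const)

lemma borel_measurable_linear_remainder:
  assumes [measurable]: "\<And>l. l \<in> {1..n} \<Longrightarrow> (\<lambda>p. f p l) \<in> borel_measurable N" "\<And>l. l \<in> {1..n} \<Longrightarrow> (\<lambda>p. g p l) \<in> borel_measurable N"
  shows "(\<lambda>p. linear_remainder n \<rho> \<theta> \<mu> (f p) (g p)) \<in> borel_measurable N"
proof -
  have [measurable]: "(\<lambda>p. theta_hat n (\<lambda>l. f p l * g p l) j) \<in> borel_measurable N" for j
    using assms by (intro borel_measurable_theta_hat) measurable
  show ?thesis unfolding linear_remainder_def by measurable
qed

lemma borel_measurable_quadratic_remainder:
  assumes [measurable]: "\<And>l. l \<in> {1..n} \<Longrightarrow> (\<lambda>p. f p l) \<in> borel_measurable N" "\<And>l. l \<in> {1..n} \<Longrightarrow> (\<lambda>p. g p l) \<in> borel_measurable N"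
  shows "(\<lambda>p. quadratic_remainder n \<rho> U a (f p) (g p)) \<in> borel_measurable N"
proof -
  have [measurable]: "(\<lambda>p. emp_norm_sq n (f p)) \<in> borel_measurable N"
    unfolding emp_norm_sq_def by (intro borel_measurable_emp_inner assms)
  have [measurable]: "(\<lambda>p. diagonal_part n a (f p) (g p)) \<in> borel_measurable N"
    unfolding diagonal_part_def by measurable
  have [measurable]: "(\<lambda>p. off_diagonal_part n a (f p) (g p)) \<in> borel_measurable N"
    unfolding off_diagonal_part_def
    by (rule borel_measurable_sum) (auto simp: upper_pairs_def intro!: borel_measurable_times assms borel_measurable_divide)
  show ?thesis unfolding quadratic_remainder_def inflated_penalty_def by measurable
qed

lemma theta_hat_cong:
  assumes "\<And>l. l \<in> {1..n} \<Longrightarrow> f l = g l"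
  shows "theta_hat n f = theta_hat n g"
  using assms by (auto simp: fun_eq_iff theta_hat_def emp_inner_def intro!: sum.cong)

lemma empirical_error_cong:
  assumes "\<And>l. l \<in> {1..n} \<Longrightarrow> f l = g l"
  shows "empirical_error n S f a = empirical_error n S g a"
proof -
  have "theta_hat n f = theta_hat n g" using assms by (rule theta_hat_cong)
  then show ?thesis by (simp add: empirical_error_def S_hat_def)
qed

lemma linear_remainder_cong:
  assumes "\<And>l. l \<in> {1..n} \<Longrightarrow> s l = s' l" "\<And>l. l \<in> {1..n} \<Longrightarrow> x l = x' l"
  shows "linear_remainder n \<rho> \<theta> \<mu> s x = linear_remainder n \<rho> \<theta> \<mu> s' x'"
proof -
  have "theta_hat n (\<lambda>l. s l * x l) = theta_hat n (\<lambda>l. s' l * x' l)"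
    using assms by (intro theta_hat_cong) simp
  then show ?thesis by (simp add: linear_remainder_def)
qed

lemma quadratic_remainder_cong:
  assumes "\<And>l. l \<in> {1..n} \<Longrightarrow> s l = s' l" "\<And>l. l \<in> {1..n} \<Longrightarrow> x l = x' l"
  shows "quadratic_remainder n \<rho> U a s x = quadratic_remainder n \<rho> U a s' x'"
proof -
  have "diagonal_part n a s x = diagonal_part n a s' x'"
    using assms by (auto simp: diagonal_part_def intro!: sum.cong)
  moreover have "off_diagonal_part n a s x = off_diagonal_part n a s' x'"
    using assms by (auto simp: off_diagonal_part_def upper_pairs_def intro!: sum.cong)
  moreover have "emp_norm_sq n s = emp_norm_sq n s'"
    using assms by (auto simp: emp_norm_sq_def emp_inner_def intro!: sum.cong)
  ultimately show ?thesis by (simp add: quadratic_remainder_def inflated_penalty_def)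
qed

lemma basis_kernel_minus_sum:
  "basis_kernel n (\<lambda>j. a j ^ i) l l - (\<Sum>j=1..n. a j ^ i)
    = (\<Sum>j=1..n. a j ^ i * ((trig_basis j (design n l))\<^sup>2 - 1))"
  by (simp add: basis_kernel_def right_diff_distrib sum_subtractf power2_eq_square mult.assoc)

lemma u_const_ge:
  assumes "finite \<Lambda>" "a \<in> \<Lambda>" "l \<in> {1..n}"
  shows "\<bar>basis_kernel n (\<lambda>j. a j ^ i) l l - (\<Sum>j=1..n. a j ^ i)\<bar> \<le> u_const i n \<Lambda>"
proof -
  let ?f = "\<lambda>a l. \<bar>\<Sum>j=1..n. a j ^ i * ((trig_basis j (design n l))\<^sup>2 - 1)\<bar>"
  have "?f a l \<le> (MAX l\<in>{1..n}. ?f a l)" using assms by (intro Max_ge) auto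
  also have "\<dots> \<le> u_const i n \<Lambda>" unfolding u_const_def using assms by (intro Max_ge) auto
  finally show ?thesis unfolding basis_kernel_minus_sum .
qed

lemma v_const_ge: "finite \<Lambda> \<Longrightarrow> a \<in> \<Lambda> \<Longrightarrow> (\<Sum>j=1..n. a j) \<le> v_const n \<Lambda>"
  unfolding v_const_def by (intro Max_ge) auto

text \<open>Up to the common factor w / (1 - 3 \<rho>), the terms with 16 \<nu> / \<rho>, u and v
  agree. The right side has 2 \<nu> / \<rho> against \<nu> / \<rho> from the linear remainder, and 2
  \<rho> (1 - \<rho>) u2 against 7/4 \<rho> (1 - \<rho>) u2.\<close>

lemma Psi_dominates:
  fixes \<rho> w \<nu> u u2 v q :: real
  assumes \<rho>: "0 < \<rho>" "\<rho> < 1 / 3" and "0 \<le> w" "0 \<le> \<nu>" "0 \<le> u2"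
  defines "t \<equiv> (1 - \<rho>) / (1 - 3 * \<rho>)"
  shows "5 / 4 * \<rho> * t * (u2 * w) + t * (\<nu> * (w / (\<rho> * (1 - \<rho>)) + 2 * (2 * ((u + v) * w * q) + 4 / \<rho> * (2 * w))))
      + t * (4 * (u * w) + \<rho> / 2 * (u2 * w))
    \<le> (\<rho> * (1 - \<rho>) * (16 * \<nu> / \<rho> + 4 * u * (1 + \<nu> * q) + 4 * \<nu> * v * q) + 2 * \<nu> + 2 * \<rho>\<^sup>2 * (1 - \<rho>) * u2)
        / (\<rho> * (1 - 3 * \<rho>)) * w" (is "?L \<le> ?R")
proof -
  define d where "d = 1 / (1 - 3 * \<rho>)"
  \<comment> \<open>With \<open>\<rho> * r = 1\<close>, and \<open>d\<close> and \<open>X\<close>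
    for the other quotients, the comparison becomes a polynomial identity for the
    difference.\<close>
  define r where "r = 1 / \<rho>"
  have r: "\<rho> * r = 1" using \<rho> by (simp add: r_def)
  define X where "X = w / (\<rho> * (1 - \<rho>))"
  have k: "(1 - \<rho>) * X = w * r" using \<rho> by (simp add: r_def X_def)
  have t: "t = d * (1 - \<rho>)" and r4: "4 / \<rho> = 4 * r" by (simp_all add: t_def d_def r_def)
  have L: "?L = d * (5 / 4 * \<rho> * (1 - \<rho>) * (u2 * w) + \<nu> * (w * r) + (1 - \<rho>) * (\<nu> * (2 * (2 * ((u + v) * w * q) + 4 * r * (2 * w))))
      + (1 - \<rho>) * (4 * (u * w) + \<rho> / 2 * (u2 * w)))"
    unfolding k[symmetric] t r4 X_def[symmetric] by (simp add: algebra_simps)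
  have "?R = d * r * (\<rho> * (1 - \<rho>) * (16 * \<nu> * r + 4 * u * (1 + \<nu> * q) + 4 * \<nu> * v * q) + 2 * \<nu> + 2 * \<rho>\<^sup>2 * (1 - \<rho>) * u2) * w"
    by (simp add: d_def r_def)
  also have "\<dots> = d * (\<rho> * r) * (1 - \<rho>) * (16 * \<nu> * r + 4 * u * (1 + \<nu> * q) + 4 * \<nu> * v * q) * w
      + 2 * d * r * \<nu> * w + 2 * d * (\<rho> * r) * \<rho> * (1 - \<rho>) * u2 * w"
    by (simp add: algebra_simps power2_eq_square)
  finally have R: "?R = d * (\<rho> * r) * (1 - \<rho>) * (16 * \<nu> * r + 4 * u * (1 + \<nu> * q) + 4 * \<nu> * v * q) * w
      + 2 * d * r * \<nu> * w + 2 * d * (\<rho> * r) * \<rho> * (1 - \<rho>) * u2 * w" .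
  have "?R - ?L = d * (\<nu> * (w * r) + 1 / 4 * \<rho> * (1 - \<rho>) * (u2 * w))"
    unfolding R L r by (simp add: algebra_simps diff_divide_distrib)
  moreover have "0 \<le> d * (\<nu> * (w * r) + 1 / 4 * \<rho> * (1 - \<rho>) * (u2 * w))"
    using assms by (intro mult_nonneg_nonneg add_nonneg_nonneg) (auto simp: d_def r_def)
  ultimately show ?thesis by linarith
qed

section \<open>Random volatilities: conditioning and expectations\<close>

locale oracle_model = standardized_noise M n \<xi> \<xi>s + odd_design n
  for M :: "'a measure" and n :: nat and \<xi> :: "nat \<Rightarrow> 'a \<Rightarrow> real" and \<xi>s :: real +
  fixes S :: "real \<Rightarrow> real" and \<sigma> :: "nat \<Rightarrow> 'a \<Rightarrow> real" and \<sigma>s \<rho> :: real and \<Lambda> :: "(nat \<Rightarrow> real) set"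
  assumes volatility_measurable [measurable]: "l \<in> {1..n} \<Longrightarrow> \<sigma> l \<in> borel_measurable M"
    and volatility_indep: "indep_var (PiM {1..n} (\<lambda>_. borel)) (\<lambda>\<omega>. \<lambda>l\<in>{1..n}. \<sigma> l \<omega>)
           (PiM {1..n} (\<lambda>_. borel)) (\<lambda>\<omega>. \<lambda>j\<in>{1..n}. \<xi> j \<omega>)"
    and volatility_AE: "AE \<omega> in M. bounded_volatility n (\<lambda>l. \<sigma> l \<omega>) \<sigma>s"
    and \<sigma>s_pos: "0 < \<sigma>s"
    and weights: "\<Lambda> \<subseteq> ({1..n} \<rightarrow>\<^sub>E {0..1})" "finite \<Lambda>" "\<Lambda> \<noteq> {}"
    and \<rho>_range: "0 < \<rho>" "\<rho> < 1/3"
begin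

text \<open>Independence is stated for tuples restricted to the indices 1 to n; the assumption
  \<open>cong\<close> replaces them by the full families.\<close>

lemma nn_integral_condition_volatility:
  fixes f :: "(nat \<Rightarrow> real) \<Rightarrow> (nat \<Rightarrow> real) \<Rightarrow> ennreal"
  assumes f: "(\<lambda>p. f (fst p) (snd p)) \<in> borel_measurable (PiM {1..n} (\<lambda>_. borel) \<Otimes>\<^sub>M PiM {1..n} (\<lambda>_. borel))"
    and cong: "\<And>s x s' x'. (\<And>l. l \<in> {1..n} \<Longrightarrow> s l = s' l) \<Longrightarrow> (\<And>l. l \<in> {1..n} \<Longrightarrow> x l = x' l) \<Longrightarrow> f s x = f s' x'"
  shows "(\<integral>\<^sup>+\<omega>. f (\<lambda>l. \<sigma> l \<omega>) (\<lambda>l. \<xi> l \<omega>) \<partial>M) = (\<integral>\<^sup>+\<omega>. (\<integral>\<^sup>+\<omega>'. f (\<lambda>l. \<sigma> l \<omega>) (\<lambda>l. \<xi> l \<omega>') \<partial>M) \<partial>M)"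
proof -
  have r: "f (\<lambda>l\<in>{1..n}. \<sigma> l \<omega>) (\<lambda>l\<in>{1..n}. \<xi> l \<omega>') = f (\<lambda>l. \<sigma> l \<omega>) (\<lambda>l. \<xi> l \<omega>')" for \<omega> \<omega>'
    by (rule cong) simp_all
  show ?thesis using nn_integral_indep_var[OF volatility_indep f] by (simp add: r del: One_nat_def)
qed

lemma weight_range: "a \<in> \<Lambda> \<Longrightarrow> j \<in> {1..n} \<Longrightarrow> 0 \<le> a j \<and> a j \<le> 1"
  using PiE_mem[of a "{1..n}" "\<lambda>_. {0..1}" j] weights(1) by auto

lemma u_const_nonneg: "0 \<le> u_const i n \<Lambda>"
proof -
  obtain a where "a \<in> \<Lambda>" using weights(3) by blast
  then have "\<bar>basis_kernel n (\<lambda>j. a j ^ i) 1 1 - (\<Sum>j=1..n. a j ^ i)\<bar> \<le> u_const i n \<Lambda>"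
    using n_pos by (intro u_const_ge weights(2)) (auto simp: Suc_le_eq)
  then show ?thesis by linarith
qed

lemma v_const_nonneg: "0 \<le> v_const n \<Lambda>"
proof -
  obtain a where a: "a \<in> \<Lambda>" using weights(3) by blast
  have "0 \<le> (\<Sum>j=1..n. a j)" using weight_range[OF a] by (intro sum_nonneg) blast
  also have "\<dots> \<le> v_const n \<Lambda>" by (rule v_const_ge[OF weights(2) a])
  finally show ?thesis .
qed

text \<open>Free of the minimizer, so its expectation can be computed. The factor 2 is there because
  the minimizer and the competitor each bring a quadratic remainder, both bounded by the full
  sum.\<close>

definition weight_remainder :: "(nat \<Rightarrow> real) \<Rightarrow> (nat \<Rightarrow> real) \<Rightarrow> (nat \<Rightarrow> real) \<Rightarrow> real" where
  "weight_remainder b s x = (\<Sum>a\<in>\<Lambda>. linear_remainder n \<rho> (theta_hat n (at_design n S)) (\<lambda>j. a j - b j) s x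
      + 2 * quadratic_remainder n \<rho> (u_const 2 n \<Lambda> * \<sigma>s) a s x)"

lemma linear_remainder_nonneg: "0 \<le> linear_remainder n \<rho> \<theta> \<mu> s x"
  unfolding linear_remainder_def using \<rho>_range
  by (intro add_nonneg_nonneg divide_nonneg_nonneg mult_nonneg_nonneg sum_nonneg) auto

lemma quadratic_remainder_nonneg: "0 \<le> quadratic_remainder n \<rho> (u_const 2 n \<Lambda> * \<sigma>s) a s x"
  unfolding quadratic_remainder_def using \<rho>_range inflated_penalty_nonneg[of "u_const 2 n \<Lambda> * \<sigma>s" n a s] u_const_nonneg \<sigma>s_pos
  by (intro add_nonneg_nonneg mult_nonneg_nonneg divide_nonneg_nonneg) auto

lemma remainders_le_weight_remainder:
  assumes "a \<in> \<Lambda>" "b \<in> \<Lambda>"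
  shows "linear_remainder n \<rho> (theta_hat n (at_design n S)) (\<lambda>j. a j - b j) s x
      + quadratic_remainder n \<rho> (u_const 2 n \<Lambda> * \<sigma>s) a s x + quadratic_remainder n \<rho> (u_const 2 n \<Lambda> * \<sigma>s) b s x
    \<le> weight_remainder b s x"
proof -
  have l: "linear_remainder n \<rho> (theta_hat n (at_design n S)) (\<lambda>j. a j - b j) s x
      \<le> (\<Sum>a\<in>\<Lambda>. linear_remainder n \<rho> (theta_hat n (at_design n S)) (\<lambda>j. a j - b j) s x)"
    using assms(1) weights(2) linear_remainder_nonneg
    by (intro member_le_sum[of a \<Lambda> "\<lambda>a. linear_remainder n \<rho> (theta_hat n (at_design n S)) (\<lambda>j. a j - b j) s x"]) auto
  have q: "quadratic_remainder n \<rho> (u_const 2 n \<Lambda> * \<sigma>s) c s x \<le> (\<Sum>a\<in>\<Lambda>. quadratic_remainder n \<rho> (u_const 2 n \<Lambda> * \<sigma>s) a s x)"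
    if "c \<in> \<Lambda>" for c
    using that weights(2) quadratic_remainder_nonneg
    by (intro member_le_sum[of c \<Lambda> "\<lambda>a. quadratic_remainder n \<rho> (u_const 2 n \<Lambda> * \<sigma>s) a s x"]) auto
  show ?thesis
    unfolding weight_remainder_def sum.distrib sum_distrib_left[symmetric] using l q[OF assms(1)] q[OF assms(2)] by linarith
qed

lemma weight_remainder_nonneg: "0 \<le> weight_remainder b s x"
  unfolding weight_remainder_def
  by (intro sum_nonneg add_nonneg_nonneg mult_nonneg_nonneg linear_remainder_nonneg quadratic_remainder_nonneg) simp

lemma borel_measurable_weight_remainder:
  assumes "\<And>l. l \<in> {1..n} \<Longrightarrow> (\<lambda>p. f p l) \<in> borel_measurable N" "\<And>l. l \<in> {1..n} \<Longrightarrow> (\<lambda>p. g p l) \<in> borel_measurable N"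
  shows "(\<lambda>p. weight_remainder b (f p) (g p)) \<in> borel_measurable N"
  unfolding weight_remainder_def
  by (intro borel_measurable_sum borel_measurable_add borel_measurable_times borel_measurable_const
      borel_measurable_linear_remainder borel_measurable_quadratic_remainder assms)

text \<open>For frozen volatilities the bound is one constant for all admissible vectors, so
  integrating over the volatilities preserves it.\<close>

lemma nn_integral_weight_remainder:
  assumes b: "b \<in> \<Lambda>"
  defines "w \<equiv> \<sigma>s / real n" and "q \<equiv> sqrt \<xi>s / sqrt (real n)"
  shows "(\<integral>\<^sup>+\<omega>. ennreal (weight_remainder b (\<lambda>l. \<sigma> l \<omega>) (\<lambda>l. \<xi> l \<omega>)) \<partial>M)
    \<le> ennreal (real (card \<Lambda>) * (w / (\<rho> * (1 - \<rho>)) + 2 * (2 * ((u_const 1 n \<Lambda> + v_const n \<Lambda>) * w * q) + 4 / \<rho> * (2 * w))))"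
    (is "_ \<le> ennreal ?c")
proof -
  have "(\<integral>\<^sup>+\<omega>'. ennreal (weight_remainder b s (\<lambda>l. \<xi> l \<omega>')) \<partial>M) \<le> ennreal ?c"
    if "bounded_volatility n s \<sigma>s" for s
  proof -
    interpret V: bounded_volatility n s \<sigma>s by fact
    interpret heteroscedastic_design n s \<sigma>s M \<xi> \<xi>s ..
    have lin: "integrable M (\<lambda>\<omega>. linear_remainder n \<rho> (theta_hat n (at_design n S)) (\<lambda>j. a j - b j) s (\<lambda>l. \<xi> l \<omega>))"
      "expectation (\<lambda>\<omega>. linear_remainder n \<rho> (theta_hat n (at_design n S)) (\<lambda>j. a j - b j) s (\<lambda>l. \<xi> l \<omega>)) \<le> w / (\<rho> * (1 - \<rho>))"
      if "a \<in> \<Lambda>" for a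
    proof -
      have "\<bar>a j - b j\<bar> \<le> 1" if "j \<in> {1..n}" for j
        using weight_range[OF \<open>a \<in> \<Lambda>\<close> that] weight_range[OF b that] by linarith
      note B = linear_remainder_bound[of \<rho> "\<lambda>j. a j - b j", OF _ _ this]
      show "integrable M (\<lambda>\<omega>. linear_remainder n \<rho> (theta_hat n (at_design n S)) (\<lambda>j. a j - b j) s (\<lambda>l. \<xi> l \<omega>))"
        "expectation (\<lambda>\<omega>. linear_remainder n \<rho> (theta_hat n (at_design n S)) (\<lambda>j. a j - b j) s (\<lambda>l. \<xi> l \<omega>)) \<le> w / (\<rho> * (1 - \<rho>))"
        using B \<rho>_range by (simp_all add: w_def)
    qed
    have quad: "integrable M (\<lambda>\<omega>. quadratic_remainder n \<rho> (u_const 2 n \<Lambda> * \<sigma>s) a s (\<lambda>l. \<xi> l \<omega>))"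
      "expectation (\<lambda>\<omega>. quadratic_remainder n \<rho> (u_const 2 n \<Lambda> * \<sigma>s) a s (\<lambda>l. \<xi> l \<omega>))
         \<le> 2 * ((u_const 1 n \<Lambda> + v_const n \<Lambda>) * w * q) + 4 / \<rho> * (2 * w)"
      if "a \<in> \<Lambda>" for a
      using quadratic_remainder_bound[of \<rho> a "v_const n \<Lambda>" "u_const 1 n \<Lambda>" "u_const 2 n \<Lambda>"]
        \<rho>_range weight_range[OF that] v_const_ge[OF weights(2) that] u_const_ge[OF weights(2) that, of _ n 1]
        u_const_ge[OF weights(2) that, of _ n 2]
      by (simp_all add: w_def q_def)
    have int: "integrable M (\<lambda>\<omega>. weight_remainder b s (\<lambda>l. \<xi> l \<omega>))"
      unfolding weight_remainder_def using lin(1) quad(1)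
      by (intro Bochner_Integration.integrable_sum Bochner_Integration.integrable_add integrable_mult_right)
    have "expectation (\<lambda>\<omega>. weight_remainder b s (\<lambda>l. \<xi> l \<omega>))
       = (\<Sum>a\<in>\<Lambda>. expectation (\<lambda>\<omega>. linear_remainder n \<rho> (theta_hat n (at_design n S)) (\<lambda>j. a j - b j) s (\<lambda>l. \<xi> l \<omega>))
          + 2 * expectation (\<lambda>\<omega>. quadratic_remainder n \<rho> (u_const 2 n \<Lambda> * \<sigma>s) a s (\<lambda>l. \<xi> l \<omega>)))"
      unfolding weight_remainder_def using lin(1) quad(1)
      by (subst Bochner_Integration.integral_sum) (auto intro!: sum.cong)
    also have "\<dots> \<le> ?c"
      using lin(2) quad(2) by (intro sum_bounded_above add_mono mult_left_mono) auto
    finally have "expectation (\<lambda>\<omega>. weight_remainder b s (\<lambda>l. \<xi> l \<omega>)) \<le> ?c" .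
    then show ?thesis
      using int weight_remainder_nonneg by (subst nn_integral_eq_integral) (auto intro: ennreal_leI)
  qed
  then have "(\<integral>\<^sup>+\<omega>. (\<integral>\<^sup>+\<omega>'. ennreal (weight_remainder b (\<lambda>l. \<sigma> l \<omega>) (\<lambda>l. \<xi> l \<omega>')) \<partial>M) \<partial>M) \<le> (\<integral>\<^sup>+\<omega>. ennreal ?c \<partial>M)"
    using volatility_AE by (intro nn_integral_mono_AE) auto
  also have "\<dots> = ennreal ?c" by (simp add: emeasure_space_1)
  also have "(\<integral>\<^sup>+\<omega>. (\<integral>\<^sup>+\<omega>'. ennreal (weight_remainder b (\<lambda>l. \<sigma> l \<omega>) (\<lambda>l. \<xi> l \<omega>')) \<partial>M) \<partial>M)
      = (\<integral>\<^sup>+\<omega>. ennreal (weight_remainder b (\<lambda>l. \<sigma> l \<omega>) (\<lambda>l. \<xi> l \<omega>)) \<partial>M)"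
  proof (rule nn_integral_condition_volatility[symmetric])
    show "(\<lambda>p. ennreal (weight_remainder b (fst p) (snd p))) \<in> borel_measurable (PiM {1..n} (\<lambda>_. borel) \<Otimes>\<^sub>M PiM {1..n} (\<lambda>_. borel))"
      by (intro measurable_compose[OF _ measurable_ennreal] borel_measurable_weight_remainder) measurable
    show "ennreal (weight_remainder b s x) = ennreal (weight_remainder b s' x')"
      if "\<And>l. l \<in> {1..n} \<Longrightarrow> s l = s' l" "\<And>l. l \<in> {1..n} \<Longrightarrow> x l = x' l" for s x s' x'
      unfolding weight_remainder_def
      by (intro arg_cong[where f = ennreal] sum.cong refl arg_cong2[where f = "(+)"] arg_cong2[where f = "(*)"]
          linear_remainder_cong quadratic_remainder_cong that)
  qed
  finally show ?thesis .
qed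

lemma observations_eq: "observations n S \<sigma> \<xi> \<omega> = (\<lambda>l. at_design n S l + \<sigma> l \<omega> * \<xi> l \<omega>)"
  by (simp add: observations_def at_design_def fun_eq_iff)

lemma int_noise_var_eq: "int_noise_var n \<sigma> \<omega> = emp_norm_sq n (\<lambda>l. \<sigma> l \<omega>)"
  by (simp add: int_noise_var_def emp_norm_sq_def emp_inner_def power2_eq_square)

lemma risk_eq:
  "risk M n S \<sigma> \<xi> L = (\<integral>\<^sup>+\<omega>. ennreal (empirical_error n S (\<lambda>l. at_design n S l + \<sigma> l \<omega> * \<xi> l \<omega>) (L \<omega>)) \<partial>M)"
  by (simp add: risk_def empirical_error_def observations_eq)

text \<open>Integrates \<open>weighted_variance_le_risk\<close> over the volatilities; by
  independence the resulting double integral is the risk.\<close>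

lemma nn_integral_penalty_le_risk:
  assumes b: "b \<in> \<Lambda>"
  shows "(\<integral>\<^sup>+\<omega>. ennreal ((\<Sum>j=1..n. (b j)\<^sup>2) * emp_norm_sq n (\<lambda>l. \<sigma> l \<omega>) / real n) \<partial>M)
    \<le> risk M n S \<sigma> \<xi> (\<lambda>_. b) + ennreal (u_const 2 n \<Lambda> * \<sigma>s / real n)"
proof -
  let ?e = "\<lambda>s x. ennreal (empirical_error n S (\<lambda>l. at_design n S l + s l * x l) b)"
  have m: "(\<lambda>p. ?e (fst p) (snd p)) \<in> borel_measurable (PiM {1..n} (\<lambda>_. borel) \<Otimes>\<^sub>M PiM {1..n} (\<lambda>_. borel))"
    by (intro measurable_compose[OF _ measurable_ennreal] borel_measurable_empirical_error) measurable
  have c: "?e s x = ?e s' x'" if "\<And>l. l \<in> {1..n} \<Longrightarrow> s l = s' l" "\<And>l. l \<in> {1..n} \<Longrightarrow> x l = x' l" for s x s' x'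
    using that by (intro arg_cong[where f = ennreal] empirical_error_cong) simp
  have r: "risk M n S \<sigma> \<xi> (\<lambda>_. b) = (\<integral>\<^sup>+\<omega>. (\<integral>\<^sup>+\<omega>'. ?e (\<lambda>l. \<sigma> l \<omega>) (\<lambda>l. \<xi> l \<omega>') \<partial>M) \<partial>M)"
    unfolding risk_eq by (rule nn_integral_condition_volatility[OF m c])
  have "ennreal ((\<Sum>j=1..n. (b j)\<^sup>2) * emp_norm_sq n s / real n)
      \<le> (\<integral>\<^sup>+\<omega>'. ?e s (\<lambda>l. \<xi> l \<omega>') \<partial>M) + ennreal (u_const 2 n \<Lambda> * \<sigma>s / real n)"
    if "bounded_volatility n s \<sigma>s" for s
  proof -
    interpret V: bounded_volatility n s \<sigma>s by fact
    interpret heteroscedastic_design n s \<sigma>s M \<xi> \<xi>s ..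
    show ?thesis
      by (rule weighted_variance_le_risk) (rule u_const_ge[OF weights(2) b])
  qed
  then have "(\<integral>\<^sup>+\<omega>. ennreal ((\<Sum>j=1..n. (b j)\<^sup>2) * emp_norm_sq n (\<lambda>l. \<sigma> l \<omega>) / real n) \<partial>M)
    \<le> (\<integral>\<^sup>+\<omega>. ((\<integral>\<^sup>+\<omega>'. ?e (\<lambda>l. \<sigma> l \<omega>) (\<lambda>l. \<xi> l \<omega>') \<partial>M) + ennreal (u_const 2 n \<Lambda> * \<sigma>s / real n)) \<partial>M)"
    using volatility_AE by (intro nn_integral_mono_AE) auto
  also have "\<dots> = risk M n S \<sigma> \<xi> (\<lambda>_. b) + ennreal (u_const 2 n \<Lambda> * \<sigma>s / real n)"
  proof (subst nn_integral_add)
    have [measurable]: "(\<lambda>p. ?e (\<lambda>l. \<sigma> l (fst p)) (\<lambda>l. \<xi> l (snd p))) \<in> borel_measurable (M \<Otimes>\<^sub>M M)"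
      by (intro measurable_compose[OF _ measurable_ennreal] borel_measurable_empirical_error) measurable
    show "(\<lambda>\<omega>. \<integral>\<^sup>+\<omega>'. ?e (\<lambda>l. \<sigma> l \<omega>) (\<lambda>l. \<xi> l \<omega>') \<partial>M) \<in> borel_measurable M"
      using borel_measurable_nn_integral_fst[of "\<lambda>p. ?e (\<lambda>l. \<sigma> l (fst p)) (\<lambda>l. \<xi> l (snd p))" M] by simp
  qed (simp_all add: r emeasure_space_1)
  finally show ?thesis .
qed

text \<open>Here \<open>c\<close> can be an estimator built from the observations as well as
  \<varsigma> itself, so both claims of the theorem are instances. The error at
  \<open>L \<omega>\<close> is compared pointwise with a measurable majorant, and only the integral
  of the majorant is split.\<close>

lemma oracle_inequality:
  assumes c [measurable]: "c \<in> borel_measurable M"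
    and arg_min: "\<And>\<omega>. \<omega> \<in> space M \<Longrightarrow>
      is_arg_min (cost n \<rho> (observations n S \<sigma> \<xi> \<omega>) (c \<omega>)) (\<lambda>a. a \<in> \<Lambda>) (L \<omega>)"
    and b: "b \<in> \<Lambda>"
  shows "risk M n S \<sigma> \<xi> L \<le> ennreal ((1 + 3 * \<rho> - 2 * \<rho>\<^sup>2) / (1 - 3 * \<rho>)) * risk M n S \<sigma> \<xi> (\<lambda>_. b)
      + ennreal (1 / real n) * B_term M n \<Lambda> \<sigma> \<xi>s \<sigma>s \<rho> c"
proof -
  define t where "t = (1 - \<rho>) / (1 - 3 * \<rho>)"
  define w where "w = \<sigma>s / real n"
  define q where "q = sqrt \<xi>s / sqrt (real n)"
  define u where "u = u_const 1 n \<Lambda>"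
  define u2 where "u2 = u_const 2 n \<Lambda>"
  define v where "v = v_const n \<Lambda>"
  define \<nu> where "\<nu> = real (card \<Lambda>)"
  define r where "r = \<nu> * (w / (\<rho> * (1 - \<rho>)) + 2 * (2 * ((u + v) * w * q) + 4 / \<rho> * (2 * w)))"
  define k where "k = t * (4 * (u * w) + \<rho> / 2 * (u2 * w))"
  define \<alpha> where "\<alpha> = (1 + \<rho>) / (1 - 3 * \<rho>)"
  define \<beta> where "\<beta> = 5 / 4 * \<rho> * t"
  define \<gamma> where "\<gamma> = t * (2 + \<rho>) * v / real n"
  define E where "E \<omega> = empirical_error n S (\<lambda>l. at_design n S l + \<sigma> l \<omega> * \<xi> l \<omega>)" for \<omega>
  define P where "P \<omega> = (\<Sum>j=1..n. (b j)\<^sup>2) * emp_norm_sq n (\<lambda>l. \<sigma> l \<omega>) / real n" for \<omega>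
  define R where "R \<omega> = weight_remainder b (\<lambda>l. \<sigma> l \<omega>) (\<lambda>l. \<xi> l \<omega>)" for \<omega>
  define D where "D \<omega> = \<bar>c \<omega> - int_noise_var n \<sigma> \<omega>\<bar>" for \<omega>
  have nn: "0 < t" "0 \<le> w" "0 \<le> u" "0 \<le> u2" "0 \<le> v" "0 \<le> \<nu>"
    using \<rho>_range \<sigma>s_pos u_const_nonneg v_const_nonneg by (auto simp: t_def w_def u_def u2_def v_def \<nu>_def)
  have q: "0 \<le> q"
  proof -
    have "0 \<le> expectation (\<lambda>\<omega>. \<xi> 1 \<omega> ^ 4)" by (intro integral_nonneg_AE AE_I2) simp
    then show ?thesis using fourth_moment[of 1] n_pos by (simp add: q_def del: One_nat_def)
  qed
  have nn2: "0 \<le> r" "0 \<le> k" "0 \<le> \<alpha>" "0 \<le> \<beta>" "0 \<le> \<gamma>"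
    using nn q \<rho>_range by (auto simp: r_def k_def \<alpha>_def \<beta>_def \<gamma>_def)
  have nnf: "0 \<le> E \<omega> a" "0 \<le> P \<omega>" "0 \<le> R \<omega>" "0 \<le> D \<omega>" for \<omega> a
    by (auto simp: E_def empirical_error_def P_def R_def D_def emp_norm_sq_nonneg weight_remainder_nonneg intro!: divide_nonneg_nonneg mult_nonneg_nonneg sum_nonneg)
  have meas [measurable]: "(\<lambda>\<omega>. E \<omega> b) \<in> borel_measurable M" "P \<in> borel_measurable M" "R \<in> borel_measurable M" "D \<in> borel_measurable M"
  proof -
    have [measurable]: "(\<lambda>\<omega>. emp_norm_sq n (\<lambda>l. \<sigma> l \<omega>)) \<in> borel_measurable M"
      unfolding emp_norm_sq_def by (intro borel_measurable_emp_inner) measurable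
    show "(\<lambda>\<omega>. E \<omega> b) \<in> borel_measurable M"
      unfolding E_def by (intro borel_measurable_empirical_error) measurable
    show "P \<in> borel_measurable M" unfolding P_def by measurable
    show "D \<in> borel_measurable M" unfolding D_def int_noise_var_eq by measurable
    show "R \<in> borel_measurable M" unfolding R_def by (intro borel_measurable_weight_remainder) measurable
  qed
  have pointwise: "E \<omega> (L \<omega>) \<le> \<alpha> * E \<omega> b + \<beta> * P \<omega> + t * R \<omega> + k + \<gamma> * D \<omega>"
    if \<omega>: "\<omega> \<in> space M" and bv: "bounded_volatility n (\<lambda>l. \<sigma> l \<omega>) \<sigma>s" for \<omega>
  proof -
    interpret bounded_volatility n "\<lambda>l. \<sigma> l \<omega>" \<sigma>s by fact
    have L: "L \<omega> \<in> \<Lambda>" using arg_min[OF \<omega>] by (simp add: is_arg_min_def)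
    have cost: "cost n \<rho> (\<lambda>l. at_design n S l + \<sigma> l \<omega> * \<xi> l \<omega>) (c \<omega>) (L \<omega>) \<le> cost n \<rho> (\<lambda>l. at_design n S l + \<sigma> l \<omega> * \<xi> l \<omega>) (c \<omega>) b"
      using arg_min[OF \<omega>] b unfolding observations_eq is_arg_min_linorder by blast
    have u1: "\<bar>basis_kernel n a l l - (\<Sum>j=1..n. a j)\<bar> \<le> u" if "a \<in> \<Lambda>" "l \<in> {1..n}" for a l
      using u_const_ge[OF weights(2) that, of 1] by (simp add: u_def)
    have "(1 - 3 * \<rho>) / (1 - \<rho>) * E \<omega> (L \<omega>) \<le> (1 + \<rho>) / (1 - \<rho>) * E \<omega> b + 5 / 4 * \<rho> * P \<omega>
      + (linear_remainder n \<rho> (theta_hat n (at_design n S)) (\<lambda>j. L \<omega> j - b j) (\<lambda>l. \<sigma> l \<omega>) (\<lambda>l. \<xi> l \<omega>)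
        + quadratic_remainder n \<rho> (u2 * \<sigma>s) (L \<omega>) (\<lambda>l. \<sigma> l \<omega>) (\<lambda>l. \<xi> l \<omega>) + quadratic_remainder n \<rho> (u2 * \<sigma>s) b (\<lambda>l. \<sigma> l \<omega>) (\<lambda>l. \<xi> l \<omega>))
      + 4 * (u * \<sigma>s / real n) + \<rho> / 2 * (u2 * \<sigma>s / real n) + (2 + \<rho>) * (v * \<bar>c \<omega> - emp_norm_sq n (\<lambda>l. \<sigma> l \<omega>)\<bar> / real n)"
      unfolding E_def P_def
      by (rule pointwise_oracle_inequality)
        (use \<rho>_range nn \<sigma>s_pos cost weight_range[OF L] weight_range[OF b] v_const_ge[OF weights(2) L] v_const_ge[OF weights(2) b] u1[OF L] u1[OF b]
          in \<open>simp_all add: v_def\<close>)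
    also have "\<dots> \<le> (1 + \<rho>) / (1 - \<rho>) * E \<omega> b + 5 / 4 * \<rho> * P \<omega> + R \<omega>
      + 4 * (u * \<sigma>s / real n) + \<rho> / 2 * (u2 * \<sigma>s / real n) + (2 + \<rho>) * (v * D \<omega> / real n)"
      using remainders_le_weight_remainder[OF L b, of "\<lambda>l. \<sigma> l \<omega>" "\<lambda>l. \<xi> l \<omega>"]
      unfolding R_def u2_def D_def int_noise_var_eq by simp
    \<comment> \<open>\<open>t\<close>, positive because \<rho> < 1/3, clears the factor in front of
      the error of the minimizer.\<close>
    finally have "t * ((1 - 3 * \<rho>) / (1 - \<rho>) * E \<omega> (L \<omega>)) \<le> t * \<dots>"
      by (rule mult_left_mono) (use nn in simp)
    moreover have "t * ((1 - 3 * \<rho>) / (1 - \<rho>) * E \<omega> (L \<omega>)) = E \<omega> (L \<omega>)"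
      using \<rho>_range by (simp add: t_def)
    moreover have "t * ((1 + \<rho>) / (1 - \<rho>) * E \<omega> b) = \<alpha> * E \<omega> b"
      using \<rho>_range by (simp add: t_def \<alpha>_def)
    ultimately show ?thesis
      by (simp add: distrib_left \<beta>_def k_def \<gamma>_def w_def mult_ac)
  qed
  have "risk M n S \<sigma> \<xi> L \<le> (\<integral>\<^sup>+\<omega>. (ennreal \<alpha> * ennreal (E \<omega> b) + ennreal \<beta> * ennreal (P \<omega>) + ennreal t * ennreal (R \<omega>) + ennreal k + ennreal \<gamma> * ennreal (D \<omega>)) \<partial>M)"
    unfolding risk_eq E_def[symmetric]
  proof (rule nn_integral_mono_AE)
    have eq: "ennreal \<alpha> * ennreal (E \<omega> b) + ennreal \<beta> * ennreal (P \<omega>) + ennreal t * ennreal (R \<omega>) + ennreal k + ennreal \<gamma> * ennreal (D \<omega>)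
      = ennreal (\<alpha> * E \<omega> b + \<beta> * P \<omega> + t * R \<omega> + k + \<gamma> * D \<omega>)" for \<omega>
      using nn nn2 nnf by (simp add: ennreal_mult)
    show "AE \<omega> in M. ennreal (E \<omega> (L \<omega>)) \<le> ennreal \<alpha> * ennreal (E \<omega> b) + ennreal \<beta> * ennreal (P \<omega>) + ennreal t * ennreal (R \<omega>) + ennreal k + ennreal \<gamma> * ennreal (D \<omega>)"
      using volatility_AE AE_space unfolding eq by eventually_elim (intro ennreal_leI pointwise)
  qed
  also have "\<dots> = ennreal \<alpha> * risk M n S \<sigma> \<xi> (\<lambda>_. b) + ennreal \<beta> * (\<integral>\<^sup>+\<omega>. ennreal (P \<omega>) \<partial>M)
      + ennreal t * (\<integral>\<^sup>+\<omega>. ennreal (R \<omega>) \<partial>M) + ennreal k + ennreal \<gamma> * (\<integral>\<^sup>+\<omega>. ennreal (D \<omega>) \<partial>M)"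
    unfolding risk_eq E_def[symmetric] by (simp add: nn_integral_add nn_integral_cmult emeasure_space_1)
  also have "\<dots> \<le> ennreal \<alpha> * risk M n S \<sigma> \<xi> (\<lambda>_. b) + ennreal \<beta> * (risk M n S \<sigma> \<xi> (\<lambda>_. b) + ennreal (u2 * w))
      + ennreal t * ennreal r + ennreal k + ennreal \<gamma> * (\<integral>\<^sup>+\<omega>. ennreal (D \<omega>) \<partial>M)"
  proof (intro add_mono mult_left_mono order_refl)
    show "(\<integral>\<^sup>+\<omega>. ennreal (P \<omega>) \<partial>M) \<le> risk M n S \<sigma> \<xi> (\<lambda>_. b) + ennreal (u2 * w)"
      using nn_integral_penalty_le_risk[OF b] by (simp add: P_def u2_def w_def)
    show "(\<integral>\<^sup>+\<omega>. ennreal (R \<omega>) \<partial>M) \<le> ennreal r"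
      using nn_integral_weight_remainder[OF b] unfolding R_def r_def \<nu>_def u_def v_def w_def q_def .
  qed simp_all
  also have "\<dots> = (ennreal \<alpha> + ennreal \<beta>) * risk M n S \<sigma> \<xi> (\<lambda>_. b)
      + ((ennreal \<beta> * ennreal (u2 * w) + ennreal t * ennreal r + ennreal k) + ennreal \<gamma> * (\<integral>\<^sup>+\<omega>. ennreal (D \<omega>) \<partial>M))"
    by (simp add: distrib_left distrib_right ac_simps)
  also have "\<dots> = ennreal (\<alpha> + \<beta>) * risk M n S \<sigma> \<xi> (\<lambda>_. b)
      + (ennreal (\<beta> * (u2 * w) + t * r + k) + ennreal \<gamma> * (\<integral>\<^sup>+\<omega>. ennreal (D \<omega>) \<partial>M))"
    using nn nn2 by (simp add: ennreal_mult)
  also have "\<dots> \<le> ennreal ((1 + 3 * \<rho> - 2 * \<rho>\<^sup>2) / (1 - 3 * \<rho>)) * risk M n S \<sigma> \<xi> (\<lambda>_. b)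
      + (ennreal (1 / real n * Psi n \<Lambda> \<xi>s \<sigma>s \<rho>) + ennreal (1 / real n * (kappa \<rho> * v)) * (\<integral>\<^sup>+\<omega>. ennreal (D \<omega>) \<partial>M))"
  proof (intro add_mono mult_right_mono ennreal_leI)
    \<comment> \<open>The numerator in the theorem is 1 + \<rho> + 2 \<rho> (1 - \<rho>), with 2
      where 5/4 stands here.\<close>
    have "\<alpha> + \<beta> = (1 + \<rho> + 5 / 4 * \<rho> * (1 - \<rho>)) / (1 - 3 * \<rho>)"
      by (simp add: \<alpha>_def \<beta>_def t_def add_divide_distrib)
    also have "\<dots> \<le> (1 + 3 * \<rho> - 2 * \<rho>\<^sup>2) / (1 - 3 * \<rho>)"
    proof (rule divide_right_mono)
      have "0 \<le> 3 / 4 * \<rho> * (1 - \<rho>)" using \<rho>_range by simp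
      moreover have "1 + 3 * \<rho> - 2 * \<rho>\<^sup>2 - (1 + \<rho> + 5 / 4 * \<rho> * (1 - \<rho>)) = 3 / 4 * \<rho> * (1 - \<rho>)"
        by (simp add: power2_eq_square field_simps)
      ultimately show "1 + \<rho> + 5 / 4 * \<rho> * (1 - \<rho>) \<le> 1 + 3 * \<rho> - 2 * \<rho>\<^sup>2" by linarith
    qed (use \<rho>_range in simp)
    finally show "\<alpha> + \<beta> \<le> (1 + 3 * \<rho> - 2 * \<rho>\<^sup>2) / (1 - 3 * \<rho>)" .
    have "1 / real n * Psi n \<Lambda> \<xi>s \<sigma>s \<rho> = (\<rho> * (1 - \<rho>) * (16 * \<nu> / \<rho> + 4 * u * (1 + \<nu> * q) + 4 * \<nu> * v * q) + 2 * \<nu> + 2 * \<rho>\<^sup>2 * (1 - \<rho>) * u2)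
        / (\<rho> * (1 - 3 * \<rho>)) * w"
      unfolding Psi_def Upsilon_star_def \<nu>_def u_def u2_def v_def q_def w_def by simp
    then show "\<beta> * (u2 * w) + t * r + k \<le> 1 / real n * Psi n \<Lambda> \<xi>s \<sigma>s \<rho>"
      using Psi_dominates[OF \<rho>_range nn(2,6,4), of u v q] unfolding \<beta>_def k_def r_def t_def by simp
    \<comment> \<open>The numerator of \<open>kappa\<close> exceeds what is needed by (1 - \<rho>)
      (2 + 3 \<rho>).\<close>
    have "(1 - \<rho>) * (2 + \<rho>) * v \<le> 4 * (1 - \<rho>\<^sup>2) * v"
    proof (rule mult_right_mono)
      have "0 \<le> (1 - \<rho>) * (2 + 3 * \<rho>)" using \<rho>_range by simp
      then show "(1 - \<rho>) * (2 + \<rho>) \<le> 4 * (1 - \<rho>\<^sup>2)" by (simp add: power2_eq_square algebra_simps)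
    qed (use nn in simp)
    then have "(1 - \<rho>) * (2 + \<rho>) * v / ((1 - 3 * \<rho>) * real n) \<le> 4 * (1 - \<rho>\<^sup>2) * v / ((1 - 3 * \<rho>) * real n)"
      by (rule divide_right_mono) (use \<rho>_range in simp)
    then show "\<gamma> \<le> 1 / real n * (kappa \<rho> * v)"
      by (simp add: \<gamma>_def t_def kappa_def mult_ac)
  qed simp_all
  also have "ennreal (1 / real n * Psi n \<Lambda> \<xi>s \<sigma>s \<rho>) + ennreal (1 / real n * (kappa \<rho> * v)) * (\<integral>\<^sup>+\<omega>. ennreal (D \<omega>) \<partial>M)
      = ennreal (1 / real n) * B_term M n \<Lambda> \<sigma> \<xi>s \<sigma>s \<rho> c"
    unfolding B_term_def D_def v_def
    by (simp only: ennreal_mult'[of "1 / real n"] of_nat_0_le_iff divide_nonneg_nonneg zero_le_one distrib_left mult.assoc)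
  finally show ?thesis .
qed

end

theorem theorem2p1:
  fixes M :: "'a measure"
    and n :: nat
    and S :: "real \<Rightarrow> real"
    and \<sigma> \<xi> :: "nat \<Rightarrow> 'a \<Rightarrow> real"
    and \<xi>s \<sigma>s \<rho> :: real
    and \<Lambda> :: "(nat \<Rightarrow> real) set"
  assumes "prob_space M"
    and "n \<ge> 3" and "odd n"
    and "prob_space.indep_vars M (\<lambda>_. borel) \<xi> {1..n}"
    and "\<And>j. j \<in> {1..n} \<Longrightarrow> distr M borel (\<xi> j) = distr M borel (\<xi> 1)"
    and "integrable M (\<lambda>\<omega>. \<xi> 1 \<omega> ^ 4)"
    and "(\<integral>\<omega>. \<xi> 1 \<omega> \<partial>M) = 0"
    and "(\<integral>\<omega>. (\<xi> 1 \<omega>)\<^sup>2 \<partial>M) = 1"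
    and "(\<integral>\<omega>. \<xi> 1 \<omega> ^ 4 \<partial>M) = \<xi>s"
    and "\<And>l. l \<in> {1..n} \<Longrightarrow> \<sigma> l \<in> borel_measurable M"
    and "prob_space.indep_var M
           (PiM {1..n} (\<lambda>_. borel)) (\<lambda>\<omega>. \<lambda>l\<in>{1..n}. \<sigma> l \<omega>)
           (PiM {1..n} (\<lambda>_. borel)) (\<lambda>\<omega>. \<lambda>j\<in>{1..n}. \<xi> j \<omega>)"
    and "AE \<omega> in M. \<forall>l\<in>{1..n}. \<sigma> l \<omega> > 0"
    and "\<sigma>s > 0"
    and "AE \<omega> in M. (MAX l\<in>{1..n}. (\<sigma> l \<omega>)\<^sup>2) \<le> \<sigma>s"
    and "\<Lambda> \<subseteq> ({1..n} \<rightarrow>\<^sub>E {0..1})" and "finite \<Lambda>" and "\<Lambda> \<noteq> {}"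
    and "0 < \<rho>" and "\<rho> < 1/3"
  shows "(\<forall>(h :: (nat \<Rightarrow> real) \<Rightarrow> real) (vhat :: 'a \<Rightarrow> real) (lhat :: 'a \<Rightarrow> nat \<Rightarrow> real).
            h \<in> borel_measurable (PiM {1..n} (\<lambda>_. borel)) \<longrightarrow>
            vhat = (\<lambda>\<omega>. h (\<lambda>j\<in>{1..n}. observations n S \<sigma> \<xi> \<omega> j)) \<longrightarrow>
            (\<forall>\<omega>\<in>space M. is_arg_min
               (cost n \<rho> (observations n S \<sigma> \<xi> \<omega>) (vhat \<omega>)) (\<lambda>lam. lam \<in> \<Lambda>) (lhat \<omega>)) \<longrightarrow>
            risk M n S \<sigma> \<xi> lhat
              \<le> ennreal ((1 + 3 * \<rho> - 2 * \<rho>\<^sup>2) / (1 - 3 * \<rho>))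
                  * (MIN lam\<in>\<Lambda>. risk M n S \<sigma> \<xi> (\<lambda>_. lam))
                + ennreal (1 / real n) * B_term M n \<Lambda> \<sigma> \<xi>s \<sigma>s \<rho> vhat)
       \<and> (\<forall>lhat :: 'a \<Rightarrow> nat \<Rightarrow> real.
            (\<forall>\<omega>\<in>space M. is_arg_min
               (cost n \<rho> (observations n S \<sigma> \<xi> \<omega>) (int_noise_var n \<sigma> \<omega>)) (\<lambda>lam. lam \<in> \<Lambda>) (lhat \<omega>)) \<longrightarrow>
            risk M n S \<sigma> \<xi> lhat
              \<le> ennreal ((1 + 3 * \<rho> - 2 * \<rho>\<^sup>2) / (1 - 3 * \<rho>))
                  * (MIN lam\<in>\<Lambda>. risk M n S \<sigma> \<xi> (\<lambda>_. lam))
                + ennreal (1 / real n) * ennreal (Psi n \<Lambda> \<xi>s \<sigma>s \<rho>))"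
proof -
  interpret prob_space M by fact
  have \<xi>_measurable [measurable]: "\<xi> j \<in> borel_measurable M" if "j \<in> {1..n}" for j
    using assms(4) that by (auto simp: indep_vars_def)
  have one: "1 \<in> {1..n}" using assms(2) by simp
  \<comment> \<open>Both sides are integrals of \<open>g\<close> against the common law of the
    noise, so moments transfer from \<xi>_1 to every \<xi>_j.\<close>
  have moments: "expectation (\<lambda>\<omega>. g (\<xi> j \<omega>)) = expectation (\<lambda>\<omega>. g (\<xi> 1 \<omega>))"
      "integrable M (\<lambda>\<omega>. g (\<xi> j \<omega>)) \<longleftrightarrow> integrable M (\<lambda>\<omega>. g (\<xi> 1 \<omega>))"
    if "g \<in> borel_measurable borel" "j \<in> {1..n}" for g :: "real \<Rightarrow> real" and j
    using that assms(5)[OF that(2)] integral_distr[OF \<xi>_measurable[OF that(2)] that(1)] integral_distr[OF \<xi>_measurable[OF one] that(1)]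
      integrable_distr_eq[OF \<xi>_measurable[OF that(2)] that(1)] integrable_distr_eq[OF \<xi>_measurable[OF one] that(1)]
    by simp_all
  have noise: "standardized_noise M n \<xi> \<xi>s"
  proof
    show "indep_vars (\<lambda>_. borel) \<xi> {1..n}" by fact
    fix j assume j: "j \<in> {1..n}"
    show "integrable M (\<lambda>\<omega>. \<xi> j \<omega> ^ 4)" using moments(2)[OF _ j, of "\<lambda>x. x ^ 4"] assms(6) by simp
    show "expectation (\<xi> j) = 0" using moments(1)[OF _ j, of "\<lambda>x. x"] assms(7) by simp
    show "expectation (\<lambda>\<omega>. (\<xi> j \<omega>)\<^sup>2) = 1" using moments(1)[OF _ j, of "\<lambda>x. x\<^sup>2"] assms(8) by simp
    show "expectation (\<lambda>\<omega>. \<xi> j \<omega> ^ 4) = \<xi>s" using moments(1)[OF _ j, of "\<lambda>x. x ^ 4"] assms(9) by simp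
  qed
  have design: "odd_design n" by unfold_locales fact
  have volatility: "AE \<omega> in M. bounded_volatility n (\<lambda>l. \<sigma> l \<omega>) \<sigma>s"
    using assms(12,14)
  proof eventually_elim
    case (elim \<omega>)
    have "(\<sigma> l \<omega>)\<^sup>2 \<le> \<sigma>s" if "l \<in> {1..n}" for l
    proof -
      have "(\<sigma> l \<omega>)\<^sup>2 \<le> (MAX l\<in>{1..n}. (\<sigma> l \<omega>)\<^sup>2)" using that by (intro Max_ge) auto
      then show ?thesis using elim(2) by linarith
    qed
    then show ?case
      using design elim(1) by (auto simp: bounded_volatility_def bounded_volatility_axioms_def)
  qed
  interpret oracle_model M n \<xi> \<xi>s S \<sigma> \<sigma>s \<rho> \<Lambda>
    by (intro oracle_model.intro oracle_model_axioms.intro noise design volatility assms)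
  \<comment> \<open>As \<open>\<Lambda>\<close> is finite and nonempty, the least risk is attained,
    and a single competitor \<open>b\<close> suffices.\<close>
  have "(MIN b\<in>\<Lambda>. risk M n S \<sigma> \<xi> (\<lambda>_. b)) \<in> (\<lambda>b. risk M n S \<sigma> \<xi> (\<lambda>_. b)) ` \<Lambda>"
    using weights by (intro Min_in) auto
  then obtain b where b: "b \<in> \<Lambda>" "(MIN b\<in>\<Lambda>. risk M n S \<sigma> \<xi> (\<lambda>_. b)) = risk M n S \<sigma> \<xi> (\<lambda>_. b)"
    by blast
  show ?thesis
    unfolding b(2)
  proof (intro conjI allI impI)
    fix h :: "(nat \<Rightarrow> real) \<Rightarrow> real" and vhat :: "'a \<Rightarrow> real" and lhat :: "'a \<Rightarrow> nat \<Rightarrow> real"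
    assume h [measurable]: "h \<in> borel_measurable (PiM {1..n} (\<lambda>_. borel))"
      and vhat: "vhat = (\<lambda>\<omega>. h (\<lambda>j\<in>{1..n}. observations n S \<sigma> \<xi> \<omega> j))"
      and lhat: "\<forall>\<omega>\<in>space M. is_arg_min (cost n \<rho> (observations n S \<sigma> \<xi> \<omega>) (vhat \<omega>)) (\<lambda>lam. lam \<in> \<Lambda>) (lhat \<omega>)"
    have "(\<lambda>\<omega>. \<lambda>j\<in>{1..n}. observations n S \<sigma> \<xi> \<omega> j) \<in> measurable M (PiM {1..n} (\<lambda>_. borel))"
      unfolding observations_def by measurable
    then have "vhat \<in> borel_measurable M"
      unfolding vhat using h by (rule measurable_compose)
    then show "risk M n S \<sigma> \<xi> lhat
              \<le> ennreal ((1 + 3 * \<rho> - 2 * \<rho>\<^sup>2) / (1 - 3 * \<rho>)) * risk M n S \<sigma> \<xi> (\<lambda>_. b)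
                + ennreal (1 / real n) * B_term M n \<Lambda> \<sigma> \<xi>s \<sigma>s \<rho> vhat"
      using lhat b(1) by (intro oracle_inequality) auto
  next
    fix lhat :: "'a \<Rightarrow> nat \<Rightarrow> real"
    assume lhat: "\<forall>\<omega>\<in>space M. is_arg_min (cost n \<rho> (observations n S \<sigma> \<xi> \<omega>) (int_noise_var n \<sigma> \<omega>)) (\<lambda>lam. lam \<in> \<Lambda>) (lhat \<omega>)"
    have "int_noise_var n \<sigma> \<in> borel_measurable M"
      unfolding int_noise_var_def[abs_def] by measurable
    then have "risk M n S \<sigma> \<xi> lhat
              \<le> ennreal ((1 + 3 * \<rho> - 2 * \<rho>\<^sup>2) / (1 - 3 * \<rho>)) * risk M n S \<sigma> \<xi> (\<lambda>_. b)
                + ennreal (1 / real n) * B_term M n \<Lambda> \<sigma> \<xi>s \<sigma>s \<rho> (int_noise_var n \<sigma>)"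
      using lhat b(1) by (intro oracle_inequality) auto
    \<comment> \<open>With the true integrated variance in place of an estimator, the deviation
      integral in \<open>B_term\<close> is 0.\<close>
    then show "risk M n S \<sigma> \<xi> lhat
              \<le> ennreal ((1 + 3 * \<rho> - 2 * \<rho>\<^sup>2) / (1 - 3 * \<rho>)) * risk M n S \<sigma> \<xi> (\<lambda>_. b)
                + ennreal (1 / real n) * ennreal (Psi n \<Lambda> \<xi>s \<sigma>s \<rho>)"
      by (simp add: B_term_def)
  qed
qed

end
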